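(* Let $k\ge 1$ be an integer and $\theta = 2\pi/(4k+3)$. Let $P$ be a finite set of points in general position and $S$ a set of constraints on $P$. Let $u,w\in P$ be two vertices such that $u$ can see $w$, let $m$ be the midpoint of the side of the canonical triangle $T_{uw}$ opposite $u$, and let $\alpha$ be the unsigned angle between $uw$ and $um$. Then there exists a path connecting $u$ and $w$ in the constrained $\theta_{(4k+3)}$-graph of $P$ with respect to $S$ of length at most \[\left( \frac{\cos \alpha}{\cos \left(\frac{\theta}{2}\right)} + \frac{\left( \cos \alpha \cdot \tan \left(\frac{\theta}{2}\right) + \sin \alpha \right) \cdot \cos \left(\frac{\theta}{4}\right)}{\cos \left(\frac{\theta}{2}\right) - \sin \left(\frac{3\theta}{4}\right)} \right) \cdot |u w|.\]
   Context: $P$ is a finite set of points in the plane and $S$ is a set of line segments (called constraints), each joining two points of $P$, such that no two constraints intersect properly. Two points $u,v\in P$ can see each other if and only if the segment $uv$ does not properly intersect any constraint or $uv$ is itself a constraint. Fix an integer $k\ge 1$, $x\in\{2,3,4,5\}$ and $\theta=2\pi/(4k+x)$. Around each point $u$, the $4k+x$ rays from $u$ with angle $\theta$ between consecutive rays define cones; they are oriented so that the bisector of one cone, $C_0^u$, is the vertical half-line above $u$, and the cones are numbered $C_0^u, C_1^u, \dots$ clockwise; all points use the same orientation. For every constraint $uv$ with $v\in C_i^u$, the line through that constraint splits $C_i^u$; the resulting pieces are the subcones of $C_i^u$ (if a constraint $uv$ splits a cone of $u$ into two subcones, $v$ is considered to lie in both; a cone not split is a single subcone). The constrained $\theta_{(4k+x)}$-graph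 has vertex set $P$ and, for each vertex $u$ and each subcone of each cone $C_i^u$, an edge between $u$ and the vertex $v$ of that subcone that can see $u$ and whose orthogonal projection onto the bisector of the full cone $C_i^u$ (not of the subcone) is closest to $u$ among all vertices of that subcone that can see $u$. Edges are weighted by Euclidean length, and the length of a path is the sum of its edge lengths. General position: no two points lie on a line parallel to one of the rays defining the cones, no two points lie on a line perpendicular to the bisector of a cone, and no three points are collinear. For a vertex $w$ in cone $C_i^u$, the canonical triangle $T_{uw}$ is the triangle bounded by the two boundary rays of $C_i^u$ and the line through $w$ perpendicular to the bisector of $C_i^u$. *)

theory Defs
  imports "HOL-Analysis.Analysis"
begin

type_synonym pt = "real \<times> real"

text \<open>Number of cones N; cone angle theta = 2 pi / N. Cone i has bisector direction
  obtained by rotating the upward vertical direction clockwise by i * theta.\<close>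

definition cone_dir :: "nat \<Rightarrow> nat \<Rightarrow> pt" where
  "cone_dir N i = (sin (real i * (2*pi/real N)), cos (real i * (2*pi/real N)))"

definition cone_perp :: "nat \<Rightarrow> nat \<Rightarrow> pt" where
  "cone_perp N i = (cos (real i * (2*pi/real N)), - sin (real i * (2*pi/real N)))"

text \<open>Direction of the cone-defining rays (boundaries at clockwise angle j*theta + theta/2).\<close>
definition ray_dir :: "nat \<Rightarrow> nat \<Rightarrow> pt" where
  "ray_dir N j = (sin (real j * (2*pi/real N) + pi/real N), cos (real j * (2*pi/real N) + pi/real N))"

definition cross2 :: "pt \<Rightarrow> pt \<Rightarrow> real" where
  "cross2 a b = fst a * snd b - snd a * fst b"

definition proj :: "nat \<Rightarrow> nat \<Rightarrow> pt \<Rightarrow> pt \<Rightarrow> real" where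
  "proj N i u x = (x - u) \<bullet> cone_dir N i"

definition offs :: "nat \<Rightarrow> nat \<Rightarrow> pt \<Rightarrow> pt \<Rightarrow> real" where
  "offs N i u x = (x - u) \<bullet> cone_perp N i"

text \<open>x lies in cone C_i^u (open cone of half-angle theta/2 = pi/N around the bisector).\<close>
definition in_cone :: "nat \<Rightarrow> pt \<Rightarrow> nat \<Rightarrow> pt \<Rightarrow> bool" where
  "in_cone N u i x \<longleftrightarrow> i < N \<and> proj N i u x > 0 \<and> \<bar>offs N i u x\<bar> < proj N i u x * tan (pi / real N)"

text \<open>Angular coordinate (tangent of the clockwise angle from the bisector) inside cone i.\<close>
definition slope :: "nat \<Rightarrow> nat \<Rightarrow> pt \<Rightarrow> pt \<Rightarrow> real" where
  "slope N i u x = offs N i u x / proj N i u x"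

definition is_constraint :: "(pt \<times> pt) set \<Rightarrow> pt \<Rightarrow> pt \<Rightarrow> bool" where
  "is_constraint S a b \<longleftrightarrow> (a, b) \<in> S \<or> (b, a) \<in> S"

definition proper_cross :: "pt \<Rightarrow> pt \<Rightarrow> pt \<Rightarrow> pt \<Rightarrow> bool" where
  "proper_cross a b c d \<longleftrightarrow> open_segment a b \<inter> open_segment c d \<noteq> {}"

definition valid_constraints :: "pt set \<Rightarrow> (pt \<times> pt) set \<Rightarrow> bool" where
  "valid_constraints P S \<longleftrightarrow>
     (\<forall>(a,b)\<in>S. a \<in> P \<and> b \<in> P \<and> a \<noteq> b) \<and>
     (\<forall>(a,b)\<in>S. \<forall>(c,d)\<in>S. {a,b} \<noteq> {c,d} \<longrightarrow> \<not> proper_cross a b c d)"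

definition sees :: "(pt \<times> pt) set \<Rightarrow> pt \<Rightarrow> pt \<Rightarrow> bool" where
  "sees S u v \<longleftrightarrow> is_constraint S u v \<or> (\<forall>(a,b)\<in>S. \<not> proper_cross u v a b)"

definition general_position :: "nat \<Rightarrow> pt set \<Rightarrow> bool" where
  "general_position N P \<longleftrightarrow>
     (\<forall>a\<in>P. \<forall>b\<in>P. a \<noteq> b \<longrightarrow>
        (\<forall>j<N. cross2 (b - a) (ray_dir N j) \<noteq> 0) \<and>
        (\<forall>j<N. (b - a) \<bullet> cone_dir N j \<noteq> 0)) \<and>
     (\<forall>a\<in>P. \<forall>b\<in>P. \<forall>c\<in>P. a \<noteq> b \<and> a \<noteq> c \<and> b \<noteq> c \<longrightarrow> \<not> collinear {a, b, c})"

definition split_vals :: "pt set \<Rightarrow> (pt \<times> pt) set \<Rightarrow> nat \<Rightarrow> pt \<Rightarrow> nat \<Rightarrow> real set" where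
  "split_vals P S N u i =
     {slope N i u v | v. v \<in> P \<and> is_constraint S u v \<and> in_cone N u i v}
     \<union> {- tan (pi / real N), tan (pi / real N)}"

text \<open>A subcone of C_i^u is the closed angular range between two consecutive splitting values.\<close>
definition is_subcone :: "pt set \<Rightarrow> (pt \<times> pt) set \<Rightarrow> nat \<Rightarrow> pt \<Rightarrow> nat \<Rightarrow> real \<Rightarrow> real \<Rightarrow> bool" where
  "is_subcone P S N u i a b \<longleftrightarrow>
     a \<in> split_vals P S N u i \<and> b \<in> split_vals P S N u i \<and> a < b \<and>
     (\<forall>c\<in>split_vals P S N u i. \<not> (a < c \<and> c < b))"

definition in_subcone :: "nat \<Rightarrow> pt \<Rightarrow> nat \<Rightarrow> real \<Rightarrow> real \<Rightarrow> pt \<Rightarrow> bool" where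
  "in_subcone N u i a b x \<longleftrightarrow> in_cone N u i x \<and> a \<le> slope N i u x \<and> slope N i u x \<le> b"

definition theta_selects :: "pt set \<Rightarrow> (pt \<times> pt) set \<Rightarrow> nat \<Rightarrow> pt \<Rightarrow> pt \<Rightarrow> bool" where
  "theta_selects P S N u v \<longleftrightarrow> v \<in> P \<and>
     (\<exists>i a b. is_subcone P S N u i a b \<and> in_subcone N u i a b v \<and> sees S u v \<and>
        (\<forall>x\<in>P. in_subcone N u i a b x \<and> sees S u x \<longrightarrow> proj N i u v \<le> proj N i u x))"

definition theta_edge :: "pt set \<Rightarrow> (pt \<times> pt) set \<Rightarrow> nat \<Rightarrow> pt \<Rightarrow> pt \<Rightarrow> bool" where
  "theta_edge P S N u v \<longleftrightarrow> u \<in> P \<and> v \<in> P \<and> (theta_selects P S N u v \<or> theta_selects P S N v u)"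

definition is_path :: "(pt \<Rightarrow> pt \<Rightarrow> bool) \<Rightarrow> pt list \<Rightarrow> pt \<Rightarrow> pt \<Rightarrow> bool" where
  "is_path E xs u w \<longleftrightarrow> xs \<noteq> [] \<and> hd xs = u \<and> last xs = w \<and>
     (\<forall>j. Suc j < length xs \<longrightarrow> E (xs ! j) (xs ! Suc j))"

definition path_length :: "pt list \<Rightarrow> real" where
  "path_length xs = (\<Sum>j<length xs - 1. dist (xs ! j) (xs ! Suc j))"

text \<open>Midpoint of the side of the canonical triangle T_uw (w in cone i of u) opposite u.\<close>
definition canon_mid :: "nat \<Rightarrow> pt \<Rightarrow> nat \<Rightarrow> pt \<Rightarrow> pt" where
  "canon_mid N u i w = u + proj N i u w *\<^sub>R cone_dir N i"

definition uangle :: "pt \<Rightarrow> pt \<Rightarrow> real" where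
  "uangle x y = arccos ((x \<bullet> y) / (norm x * norm y))"

end

theory Submission
  imports Defs
begin

text \<open>
  By induction on the height of the canonical triangle, every visible pair \<open>u\<close>, \<open>w\<close> is joined by a path of
  length at most \<open>|ua| + c * max |aw| |bw|\<close>, where \<open>a\<close>, \<open>b\<close> are the corners opposite \<open>u\<close>. Let \<open>v\<close> be the
  neighbour of \<open>u\<close> in the subcone of \<open>w\<close>, say to the left of \<open>uw\<close>. Gift wrapping inside the triangle
  \<open>uvw\<close> yields a convex chain of mutually visible points from \<open>v\<close> to \<open>w\<close>; since \<open>v\<close> is closest to \<open>u\<close>,
  every step of it ascends. The induction hypothesis applies to each step in the forward direction:
  a step leaning right costs at most a linear function \<open>L\<close> of the step vector, and a step leaning left at
  most the mirrored function \<open>R\<close>. Steps leaning left come last and occur only if \<open>w\<close> is left of the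
  bisector, so the costs telescope to the claimed bound.
\<close>

section \<open>Convex chains of visible points\<close>

text \<open>The factor \<open>s\<close> will be \<open>1\<close> or \<open>-1\<close>; it lets one argument serve a configuration and its mirror image.\<close>
definition orient :: "real \<Rightarrow> pt \<Rightarrow> pt \<Rightarrow> pt \<Rightarrow> real" where
  "orient s a b c = s * cross2 (b - a) (c - a)"

section \<open>Identities for oriented areas\<close>

lemma orient_cyclic: "orient s a b c = orient s b c a"
  by (simp add: orient_def cross2_def algebra_simps)

lemma orient_swap: "orient s a c b = - orient s a b c"
  by (simp add: orient_def cross2_def algebra_simps)

lemma orient_degenerate [simp]:
  "orient s a a b = 0" "orient s a b a = 0" "orient s a b b = 0"
  by (simp_all add: orient_def cross2_def)

lemma orient_affine:
  "orient s a b ((1 - \<mu>) *\<^sub>R x + \<mu> *\<^sub>R y) = (1 - \<mu>) * orient s a b x + \<mu> * orient s a b y"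
  by (cases a, cases b, cases x, cases y) (simp add: orient_def cross2_def algebra_simps)

lemma orient_barycentric_sum:
  "orient s u w y + orient s w p y + orient s p u y = orient s u w p"
  by (simp add: orient_def cross2_def algebra_simps)

text \<open>Barycentric coordinates of \<open>y\<close> in the triangle \<open>u w p\<close>,
  cleared of denominators: \<open>orient s u w y\<close> is the weight of \<open>p\<close> and
  \<open>orient s p u y\<close> that of \<open>w\<close>. Pairing with an arbitrary \<open>n\<close>
  yields vector equations and half-plane estimates alike.\<close>

lemma orient_barycentric:
  "orient s u w p * ((y - u) \<bullet> n) = orient s u w y * ((p - u) \<bullet> n) + orient s p u y * ((w - u) \<bullet> n)"
  by (cases u, cases w, cases p, cases y, cases n) (simp add: orient_def cross2_def algebra_simps)

text \<open>Cramer's rule for \<open>v\<close> in the basis \<open>a\<close>, \<open>b\<close>,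
  paired with a linear functional.\<close>

lemma cross2_cramer:
  "cross2 a b * (v \<bullet> n) = cross2 v b * (a \<bullet> n) + cross2 a v * (b \<bullet> n)"
  by (cases a, cases b, cases v, cases n) (simp add: cross2_def algebra_simps)

text \<open>A three-term Pluecker relation. It turns the comparison of the directions of
  \<open>x\<close> and \<open>y\<close> seen from \<open>p\<close> into one between the ratios of
  their distances to the lines \<open>pu\<close> and \<open>pw\<close>.\<close>

lemma orient_pluecker:
  "orient s u w p * orient s p x y = orient s w p x * orient s p u y - orient s p u x * orient s w p y"
  by (cases u, cases w, cases p, cases x, cases y) (simp add: orient_def cross2_def algebra_simps)

lemma collinear_if_orient_0:
  assumes "orient s a b c = 0" "s \<noteq> 0"
  shows "collinear {a, b, c}"
proof (cases "b = a")
  case True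
  then show ?thesis by (simp add: insert_absorb)
next
  case False
  obtain x y where xy: "b - a = (x, y)" by fastforce
  obtain x' y' where xy': "c - a = (x', y')" by fastforce
  have eq: "x * y' = y * x'"
    using assms xy xy' by (simp add: orient_def cross2_def)
  have ne: "x \<noteq> 0 \<or> y \<noteq> 0"
    using False xy by (auto simp: zero_prod_def[symmetric])
  have "\<exists>k. c - a = k *\<^sub>R (b - a)"
  proof (cases "x = 0")
    case True
    then show ?thesis using eq ne unfolding xy xy' by (intro exI[of _ "y'/y"]) auto
  next
    case False
    then show ?thesis using eq unfolding xy xy' by (intro exI[of _ "x'/x"]) (auto simp: field_simps)
  qed
  then have "collinear {0, b - a, c - a}"
    by (simp add: collinear_lemma)
  then have "collinear {b, a, c}"
    by (subst collinear_3) simp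
  then show ?thesis by (simp add: insert_commute)
qed

section \<open>Points in general position with non-crossing constraints\<close>

locale constrained_points =
  fixes P :: "pt set" and S :: "(pt \<times> pt) set"
  assumes finite_P: "finite P"
    and no_three: "\<lbrakk>a \<in> P; b \<in> P; c \<in> P; a \<noteq> b; a \<noteq> c; b \<noteq> c\<rbrakk> \<Longrightarrow> \<not> collinear {a, b, c}"
    and valid: "valid_constraints P S"
begin

lemma orient_nonzero:
  "\<lbrakk>a \<in> P; b \<in> P; c \<in> P; a \<noteq> b; a \<noteq> c; b \<noteq> c; s \<noteq> 0\<rbrakk> \<Longrightarrow> orient s a b c \<noteq> 0"
  using collinear_if_orient_0 no_three by blast

lemma is_constraint_sym: "is_constraint S a b \<longleftrightarrow> is_constraint S b a"
  by (auto simp: is_constraint_def)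

lemma constraint_in_P: "is_constraint S a b \<Longrightarrow> a \<in> P \<and> b \<in> P \<and> a \<noteq> b"
  using valid by (auto simp: is_constraint_def valid_constraints_def)

lemma constraints_not_crossing:
  assumes "(a, b) \<in> S" "(c, d) \<in> S" "{a, b} \<noteq> {c, d}"
  shows "\<not> proper_cross a b c d"
proof -
  have "\<forall>(c,d)\<in>S. {a, b} \<noteq> {c, d} \<longrightarrow> \<not> proper_cross a b c d"
    using bspec[OF conjunct2[OF valid[unfolded valid_constraints_def]] assms(1)] by simp
  from bspec[OF this assms(2)] show ?thesis using assms(3) by simp
qed

text \<open>If \<open>uv\<close> is itself a constraint, the crossing contradicts planarity of the
  constraints, otherwise it contradicts visibility. The pair \<open>{u, v}\<close> is excluded
  because a constraint meets itself.\<close>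

lemma sees_not_crossed:
  assumes "sees S u v" "is_constraint S a b" "{a, b} \<noteq> {u, v}"
    "e \<in> open_segment a b" "e \<in> open_segment u v"
  shows False
proof -
  have cr: "proper_cross x y x' y'" if "{x, y} = {a, b}" "{x', y'} = {u, v}" for x y x' y'
    using assms(4,5) that open_segment_commute unfolding proper_cross_def doubleton_eq_iff by blast
  consider "is_constraint S u v" | "\<forall>(a,b)\<in>S. \<not> proper_cross u v a b"
    using assms(1) by (auto simp: sees_def)
  then show False
  proof cases
    case 1
    obtain x y where xy: "(x, y) \<in> S" "{x, y} = {a, b}"
      using assms(2) unfolding is_constraint_def by blast
    obtain x' y' where xy': "(x', y') \<in> S" "{x', y'} = {u, v}"
      using 1 unfolding is_constraint_def by blast
    have "\<not> proper_cross x y x' y'"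
      using constraints_not_crossing xy xy' assms(3) by metis
    then show False
      using cr xy(2) xy'(2) by blast
  next
    case 2
    then have "\<not> proper_cross u v a b \<or> \<not> proper_cross u v b a"
      using assms(2) by (auto simp: is_constraint_def)
    then show False
      using assms(4,5) open_segment_commute unfolding proper_cross_def by blast
  qed
qed

end

section \<open>Gift wrapping in the triangle \<open>u w p\<close>\<close>

locale visibility_triangle = constrained_points +
  fixes u w :: pt and s :: real
  assumes u_P: "u \<in> P" and w_P: "w \<in> P" and sees_uw: "sees S u w" and s_ne: "s \<noteq> 0"
begin

text \<open>\<open>u\<close> and \<open>p\<close> are left out so that a wrapping step neither
  stalls at \<open>p\<close> nor falls back to \<open>u\<close>; \<open>w\<close>, the target of the
  chain, stays in.\<close>

definition tri :: "pt \<Rightarrow> pt set" where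
  "tri p = {y \<in> P - {u, p}. 0 \<le> orient s u w y \<and> 0 \<le> orient s w p y \<and> 0 \<le> orient s p u y}"

text \<open>The last conjunct says that no constraint at \<open>u\<close> enters the angle between \<open>uw\<close> and \<open>up\<close>.\<close>
definition apex :: "pt \<Rightarrow> bool" where
  "apex p \<longleftrightarrow> p \<in> P \<and> sees S u p \<and> 0 < orient s u w p \<and>
     (\<forall>z. is_constraint S u z \<longrightarrow> \<not> (0 < orient s u w z \<and> 0 < orient s p u z))"

text \<open>Gift wrapping: \<open>x\<close> is the first point of the triangle met when turning from \<open>pu\<close> towards \<open>pw\<close>.\<close>
definition wrap_step :: "pt \<Rightarrow> pt \<Rightarrow> bool" where
  "wrap_step p x \<longleftrightarrow> x \<in> tri p \<and> (\<forall>y\<in>tri p. 0 \<le> orient s p x y)"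

lemma apex_ne: "apex p \<Longrightarrow> p \<noteq> u \<and> p \<noteq> w \<and> u \<noteq> w"
  unfolding apex_def by auto

lemma w_in_tri: "apex p \<Longrightarrow> w \<in> tri p"
  using apex_ne[of p] w_P orient_cyclic[of s p u w] unfolding tri_def apex_def by auto

lemma finite_tri: "finite (tri p)"
  using finite_P by (auto simp: tri_def)

text \<open>No three points are collinear, so no point of \<open>P\<close> other than
  \<open>p\<close> and \<open>u\<close> lies on the line \<open>pu\<close>.\<close>

lemma tri_orient_pos: 
  assumes "apex p" "y \<in> tri p"
  shows "0 < orient s p u y"
proof -
  have "p \<in> P" "u \<in> P" "y \<in> P" "p \<noteq> u" "p \<noteq> y" "u \<noteq> y"
    using assms apex_ne[of p] u_P by (auto simp: tri_def apex_def)
  then have "orient s p u y \<noteq> 0" using s_ne by (rule orient_nonzero)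
  then show ?thesis using assms by (simp add: tri_def)
qed

lemma wrap_step_exists:
  assumes "apex p" shows "\<exists>x. wrap_step p x"
proof -
  \<comment> \<open>\<open>f\<close> grows with the angle at \<open>p\<close> measured from
    \<open>pu\<close>. The sum in the denominator stays positive even at \<open>y = w\<close>, where
    \<open>orient s w p y\<close> vanishes.\<close>
  define f where "f y = orient s p u y / (orient s p u y + orient s w p y)" for y
  have "finite (f ` tri p)" "f ` tri p \<noteq> {}"
    using finite_tri w_in_tri[OF assms] by auto
  then have "Min (f ` tri p) \<in> f ` tri p" by (rule Min_in)
  then obtain x where x: "x \<in> tri p" "f x = Min (f ` tri p)"
    by fastforce
  have "0 \<le> orient s p x y" if y: "y \<in> tri p" for y
  proof -
    let ?B = "\<lambda>z. orient s p u z" and ?A = "\<lambda>z. orient s w p z"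
    have pos: "0 < ?B x" "0 \<le> ?A x" "0 < ?B y" "0 \<le> ?A y"
      using x y tri_orient_pos[OF assms] by (auto simp: tri_def)
    have "f x \<le> f y" using x y finite_tri by simp
    then have "?B x * (?B y + ?A y) \<le> ?B y * (?B x + ?A x)"
      using pos unfolding f_def by (simp add: frac_le_eq divide_le_0_iff field_simps)
    then have "?B x * ?A y \<le> ?B y * ?A x" by (simp add: algebra_simps)
    then have "0 \<le> orient s u w p * orient s p x y"
      unfolding orient_pluecker by (simp add: mult.commute)
    then show ?thesis
      using assms by (auto simp: apex_def zero_le_mult_iff)
  qed
  then show ?thesis
    using x unfolding wrap_step_def by blast
qed

text \<open>A constraint entering the empty part of the triangle cut off by the line through
  \<open>p\<close> and \<open>x\<close> would have to leave it through \<open>up\<close> or \<open>uw\<close>.\<close>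
lemma wrap_step_not_blocked:
  assumes p: "apex p" and x: "wrap_step p x" and ab: "is_constraint S a b"
    and t: "t \<in> open_segment a b" "0 < orient s p u t" "0 < orient s u w t" "orient s p x t \<le> 0"
    and b: "orient s p x b < 0"
  shows False
proof -
  let ?g1 = "orient s p u" and ?g2 = "orient s u w"
  have xt: "x \<in> tri p" and xmin: "\<And>y. y \<in> tri p \<Longrightarrow> 0 \<le> orient s p x y"
    using x by (auto simp: wrap_step_def)
  have abP: "a \<in> P" "b \<in> P" "a \<noteq> b" using constraint_in_P[OF ab] by auto
  have D: "0 < orient s u w p" using p by (simp add: apex_def)
  have u_int: "u \<notin> open_segment a b"
  proof
    assume u: "u \<in> open_segment a b"
    then have "u \<noteq> a" "u \<noteq> b" by (auto simp: open_segment_def)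
    then have "\<not> collinear {a, b, u}" using no_three abP u_P by metis
    moreover have "collinear {a, u, b}"
      using u by (intro between_imp_collinear) (auto simp: between_mem_segment open_segment_def)
    ultimately show False by (simp add: insert_commute)
  qed
  \<comment> \<open>Such a point, on a side of the angle at \<open>u\<close> and strictly on the
    \<open>u\<close>-side of the line \<open>px\<close>, lies in the open segment \<open>up\<close>
    or \<open>uw\<close>. Both segments are visible, so the constraint cannot cross them.\<close>
  have leave: False if e: "e \<in> open_segment a b" "?g1 e \<ge> 0" "?g2 e \<ge> 0" "?g1 e = 0 \<or> ?g2 e = 0"
      "orient s p x e < 0" for e
  proof (cases "?g1 e = 0")
    case True
    define \<tau> where "\<tau> = 1 - ?g2 e / orient s u w p"
    have bar: "(e - u) \<bullet> n = (1 - \<tau>) * ((p - u) \<bullet> n)" for n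
      using orient_barycentric[of s u w p e n] True D by (simp add: \<tau>_def field_simps)
    have "(e - (u + (1 - \<tau>) *\<^sub>R (p - u))) \<bullet> n = 0" for n
      using bar[of n] by (simp add: algebra_simps)
    then have e_eq: "e = (1 - \<tau>) *\<^sub>R p + \<tau> *\<^sub>R u"
      by (metis (no_types, lifting) eq_iff_diff_eq_0 inner_eq_zero_iff add.commute add_diff_eq diff_add_cancel
          scaleR_diff_left scaleR_diff_right scaleR_one diff_diff_eq2)
    have "\<tau> \<le> 1" using e D by (simp add: \<tau>_def)
    have "\<tau> \<noteq> 1" using e_eq e(1) u_int by auto
    have "orient s p x e = \<tau> * orient s p x u" unfolding e_eq orient_affine by simp
    moreover have "orient s p x u < 0"
      using tri_orient_pos[OF p xt] orient_swap[of s p x u] by linarith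
    ultimately have "\<tau> > 0" using e(5) by (simp add: mult_less_0_iff)
    have "p \<noteq> u" using apex_ne[OF p] by simp
    then have "e \<in> open_segment u p"
      using \<open>\<tau> > 0\<close> \<open>\<tau> \<le> 1\<close> \<open>\<tau> \<noteq> 1\<close> e_eq
      by (subst open_segment_commute) (auto simp: in_segment)
    moreover have "{a, b} \<noteq> {u, p}"
    proof
      assume "{a, b} = {u, p}"
      then have "t \<in> open_segment p u" using t(1) open_segment_commute by (auto simp: doubleton_eq_iff)
      then have "?g1 t = 0" by (auto simp: in_segment orient_affine)
      then show False using t by simp
    qed
    ultimately show False
      using sees_not_crossed[of u p a b e] p ab e(1) by (auto simp: apex_def)
  next
    case False
    with e have z: "?g2 e = 0" "?g1 e > 0" by auto
    define \<tau> where "\<tau> = ?g1 e / orient s u w p"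
    have bar: "(e - u) \<bullet> n = \<tau> * ((w - u) \<bullet> n)" for n
      using orient_barycentric[of s u w p e n] z D by (simp add: \<tau>_def field_simps)
    have "(e - (u + \<tau> *\<^sub>R (w - u))) \<bullet> n = 0" for n
      using bar[of n] by (simp add: algebra_simps)
    then have e_eq: "e = (1 - \<tau>) *\<^sub>R u + \<tau> *\<^sub>R w"
      by (metis (no_types, lifting) eq_iff_diff_eq_0 inner_eq_zero_iff add.commute add_diff_eq diff_add_cancel
          scaleR_diff_left scaleR_diff_right scaleR_one diff_diff_eq2)
    have "\<tau> > 0" using z D by (simp add: \<tau>_def)
    have "orient s p x u < 0"
      using tri_orient_pos[OF p xt] orient_swap[of s p x u] by linarith
    moreover have "orient s p x w \<ge> 0" using xmin w_in_tri[OF p] by simp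
    moreover have "orient s p x e = (1 - \<tau>) * orient s p x u + \<tau> * orient s p x w"
      unfolding e_eq orient_affine by simp
    ultimately have "\<tau> < 1"
      using e(5) \<open>\<tau> > 0\<close> by (smt (verit) mult_nonneg_nonneg mult_nonpos_nonpos)
    have "e \<in> open_segment u w"
      using \<open>\<tau> > 0\<close> \<open>\<tau> < 1\<close> e_eq apex_ne[OF p] by (auto simp: in_segment)
    moreover have "{a, b} \<noteq> {u, w}"
    proof
      assume "{a, b} = {u, w}"
      then have "t \<in> open_segment u w" using t(1) open_segment_commute by (auto simp: doubleton_eq_iff)
      then have "?g2 t = 0" by (auto simp: in_segment orient_affine)
      then show False using t by simp
    qed
    ultimately show False
      using sees_not_crossed[of u w a b e] sees_uw ab e(1) by auto
  qed
  show False
  proof (cases "b = u")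
    case True
    obtain \<mu> where \<mu>: "0 < \<mu>" "\<mu> < 1" "t = (1 - \<mu>) *\<^sub>R u + \<mu> *\<^sub>R a"
      using t(1) True open_segment_commute by (metis in_segment(2))
    \<comment> \<open>A constraint starting at \<open>u\<close> would enter the angle between
      \<open>uw\<close> and \<open>up\<close>, which \<open>apex\<close> forbids.\<close>
    have "0 < ?g2 a" "0 < ?g1 a"
      using t(2,3) \<mu>(1) unfolding \<mu>(3) orient_affine by (simp_all add: zero_less_mult_iff)
    then show False using p ab True is_constraint_sym unfolding apex_def by blast
  next
    case False
    have "b \<noteq> p" using b by auto
    \<comment> \<open>If \<open>b\<close> were in the angle at \<open>u\<close>, its position before
      the line \<open>px\<close> would put it into the triangle, against the choice of
      \<open>x\<close>.\<close>
    have out: "?g1 b < 0 \<or> ?g2 b < 0"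
    proof (rule ccontr)
      assume "\<not> ?thesis"
      then have nn: "?g1 b \<ge> 0" "?g2 b \<ge> 0" by auto
      have "0 < orient s p u x" using tri_orient_pos[OF p xt] .
      have "0 \<le> orient s w p x" using xt by (simp add: tri_def)
      have "orient s u w p * orient s p x b < 0" using D b by (simp add: mult_pos_neg)
      then have "orient s p u x * orient s w p b > orient s w p x * ?g1 b"
        by (simp add: orient_pluecker)
      moreover have "orient s w p x * ?g1 b \<ge> 0" using \<open>0 \<le> orient s w p x\<close> nn by simp
      ultimately have "orient s p u x * orient s w p b > 0" by linarith
      then have "orient s w p b > 0" using \<open>0 < orient s p u x\<close> by (simp add: zero_less_mult_iff)
      then have "b \<in> tri p" using nn abP False \<open>b \<noteq> p\<close> by (simp add: tri_def)
      then show False using xmin b by fastforce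
    qed
    \<comment> \<open>\<open>m\<close> is nonnegative exactly while the moving point is in the
      closed angle at \<open>u\<close>, so its zero is a point where the constraint meets a side of
      the angle.\<close>
    define m where "m \<mu> = min (?g1 ((1 - \<mu>) *\<^sub>R t + \<mu> *\<^sub>R b)) (?g2 ((1 - \<mu>) *\<^sub>R t + \<mu> *\<^sub>R b))" for \<mu>
    have "continuous_on {0..1} m"
      unfolding m_def orient_affine by (intro continuous_intros)
    moreover have "m 0 \<ge> 0" "m 1 \<le> 0" using t(2,3) out by (auto simp: m_def)
    ultimately obtain \<mu> where \<mu>: "0 \<le> \<mu>" "\<mu> \<le> 1" "m \<mu> = 0"
      using IVT2'[of m 1 0 0] by auto
    have "\<mu> \<noteq> 0" "\<mu> \<noteq> 1" using \<mu>(3) t(2,3) out by (auto simp: m_def min_def split: if_splits)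
    then have \<mu>': "0 < \<mu>" "\<mu> < 1" using \<mu> by auto
    let ?e = "(1 - \<mu>) *\<^sub>R t + \<mu> *\<^sub>R b"
    have "orient s p x ?e < 0"
      using \<mu>' t(4) b unfolding orient_affine
      by (smt (verit) mult_nonneg_nonpos mult_pos_neg)
    moreover have "?e \<in> open_segment a b"
    proof -
      obtain \<nu> where \<nu>: "0 < \<nu>" "\<nu> < 1" "t = (1 - \<nu>) *\<^sub>R a + \<nu> *\<^sub>R b"
        using t(1) by (auto simp: in_segment)
      have "?e = (1 - (\<nu> + \<mu> * (1 - \<nu>))) *\<^sub>R a + (\<nu> + \<mu> * (1 - \<nu>)) *\<^sub>R b"
        unfolding \<nu>(3) by (simp add: algebra_simps)
      moreover have "0 < \<nu> + \<mu> * (1 - \<nu>)" using \<mu>' \<nu> by (simp add: add_pos_pos)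
      moreover have "\<nu> + \<mu> * (1 - \<nu>) < 1"
      proof -
        have "0 < (1 - \<mu>) * (1 - \<nu>)" using \<mu>' \<nu> by simp
        then show ?thesis by (simp add: algebra_simps)
      qed
      ultimately show ?thesis using abP(3) unfolding in_segment by blast
    qed
    ultimately show False
      using leave[of ?e] \<mu>(3) by (auto simp: m_def min_def split: if_splits)
  qed
qed

text \<open>Serves both the chain edge \<open>px\<close> and the segment \<open>ux\<close> to the
  next apex. A blocking constraint has a point on or before the line \<open>px\<close> but, by
  \<open>wrap_step_not_blocked\<close>, no end point before it. So both ends lie on the line, and
  general position makes the constraint \<open>px\<close> itself.\<close>

lemma wrap_step_sees:
  assumes p: "apex p" and x: "wrap_step p x"
    and q: "q = p \<or> q = u \<and> x \<noteq> w"
  shows "sees S q x"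
proof (rule ccontr)
  assume "\<not> sees S q x"
  then obtain a b where ab: "(a, b) \<in> S" "proper_cross q x a b" and nc: "\<not> is_constraint S q x"
    by (auto simp: sees_def)
  then obtain t where t: "t \<in> open_segment q x" "t \<in> open_segment a b"
    by (auto simp: proper_cross_def)
  have con: "is_constraint S a b" "is_constraint S b a" using ab by (auto simp: is_constraint_def)
  have abP: "a \<in> P" "b \<in> P" "a \<noteq> b" using constraint_in_P[OF con(1)] by auto
  have xt: "x \<in> tri p" using x by (simp add: wrap_step_def)
  have xP: "x \<in> P" "x \<noteq> u" "x \<noteq> p" using xt by (auto simp: tri_def)
  have D: "0 < orient s u w p" "p \<in> P" using p by (auto simp: apex_def)
  have gx: "0 < orient s p u x" using tri_orient_pos[OF p xt] .
  have gx2: "0 \<le> orient s u w x" using xt by (simp add: tri_def)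
  have gx2': "0 < orient s u w x" if "x \<noteq> w"
    using orient_nonzero[of u w x s] gx2 that u_P w_P xP apex_ne[OF p] s_ne by force
  obtain \<mu> where \<mu>: "0 < \<mu>" "\<mu> < 1" "t = (1 - \<mu>) *\<^sub>R q + \<mu> *\<^sub>R x"
    using t(1) by (auto simp: in_segment)
  have tt: "0 < orient s p u t" "0 < orient s u w t" "orient s p x t \<le> 0"
  proof -
    show "0 < orient s p u t"
      using q \<mu>(1,2) gx unfolding \<mu>(3) orient_affine by auto
    show "0 < orient s u w t"
      using q \<mu>(1,2) gx2 gx2' D unfolding \<mu>(3) orient_affine by (auto intro: add_pos_nonneg)
    have "orient s p x u < 0" using gx orient_swap[of s p x u] by linarith
    then show "orient s p x t \<le> 0"
      using q \<mu>(1,2) unfolding \<mu>(3) orient_affine by (auto intro: mult_nonneg_nonpos)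
  qed
  have "\<not> orient s p x b < 0"
    using wrap_step_not_blocked[OF p x con(1) t(2) tt] by blast
  moreover have "\<not> orient s p x a < 0"
    using wrap_step_not_blocked[OF p x con(2) _ tt] t(2) open_segment_commute by blast
  ultimately have nn: "0 \<le> orient s p x a" "0 \<le> orient s p x b" by auto
  obtain \<nu> where \<nu>: "0 < \<nu>" "\<nu> < 1" "t = (1 - \<nu>) *\<^sub>R a + \<nu> *\<^sub>R b"
    using t(2) by (auto simp: in_segment)
  have t0: "(1 - \<nu>) * orient s p x a + \<nu> * orient s p x b \<le> 0"
    using tt(3) unfolding \<nu>(3) orient_affine .
  moreover have "0 \<le> (1 - \<nu>) * orient s p x a" "0 \<le> \<nu> * orient s p x b" using nn \<nu> by auto
  ultimately have "(1 - \<nu>) * orient s p x a = 0" "\<nu> * orient s p x b = 0" by linarith+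
  then have z: "orient s p x a = 0" "orient s p x b = 0" using \<nu> by auto
  then have "a \<in> {p, x}" "b \<in> {p, x}"
    using orient_nonzero[of p x a s] orient_nonzero[of p x b s] D xP abP s_ne by auto
  then have px: "{a, b} = {p, x}" using abP(3) by auto
  then have "is_constraint S p x" using con by (auto simp: doubleton_eq_iff)
  with nc q have "q = u" by auto
  have "orient s p x t = 0" using z unfolding \<nu>(3) orient_affine by simp
  moreover have "orient s p x t = (1 - \<mu>) * orient s p x u"
    unfolding \<mu>(3) orient_affine \<open>q = u\<close> by simp
  ultimately show False using gx orient_swap[of s p x u] \<mu> by simp
qed

text \<open>The ray \<open>ux\<close> runs inside the angle between \<open>uw\<close> and
  \<open>up\<close>, so the angle only shrinks and stays free of constraints at \<open>u\<close>.
  The triangle shrinks too and loses \<open>x\<close>, which makes the wrapping terminate.\<close>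

lemma wrap_step_apex:
  assumes p: "apex p" and x: "wrap_step p x" and "x \<noteq> w"
  shows "apex x" "tri x \<subseteq> tri p - {x}"
proof -
  have xt: "x \<in> tri p" using x by (simp add: wrap_step_def)
  have xP: "x \<in> P" "x \<noteq> u" "x \<noteq> p" using xt by (auto simp: tri_def)
  have D: "0 < orient s u w p" "p \<in> P" using p by (auto simp: apex_def)
  have gx: "0 < orient s p u x" using tri_orient_pos[OF p xt] .
  have gx2: "0 < orient s u w x"
    using orient_nonzero[of u w x s] xt assms(3) u_P w_P xP apex_ne[OF p] s_ne by (force simp: tri_def)
  have gx3: "0 \<le> orient s w p x" using xt by (simp add: tri_def)
  have sub: "0 \<le> orient s p u z"  if "0 \<le> orient s u w z" "0 \<le> orient s x u z" for z
  proof -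
    have "orient s u w x * orient s p u z = orient s p u x * orient s u w z + orient s u w p * orient s x u z"
      by (simp add: orient_def cross2_def algebra_simps)
    also have "\<dots> \<ge> 0" using that gx D by simp
    finally show ?thesis using gx2 by (simp add: zero_le_mult_iff)
  qed
  show "apex x"
    unfolding apex_def
  proof (intro conjI allI impI notI)
    show "sees S u x" using wrap_step_sees[OF p x] assms(3) by blast
    fix z assume z: "is_constraint S u z" "0 < orient s u w z \<and> 0 < orient s x u z"
    have "orient s u w x * orient s p u z = orient s p u x * orient s u w z + orient s u w p * orient s x u z"
      by (simp add: orient_def cross2_def algebra_simps)
    also have "\<dots> > 0" using z gx D by (simp add: add_pos_pos)
    finally have "0 < orient s p u z" using gx2 by (simp add: zero_less_mult_iff)
    then show False using p z unfolding apex_def by blast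
  qed (use xP gx2 in auto)
  show "tri x \<subseteq> tri p - {x}"
  proof
    fix y assume y: "y \<in> tri x"
    then have yy: "y \<in> P" "y \<noteq> u" "y \<noteq> x" "0 \<le> orient s u w y" "0 \<le> orient s w x y" "0 \<le> orient s x u y"
      by (auto simp: tri_def)
    have "orient s u w x * orient s w p y = orient s w p x * orient s u w y + orient s u w p * orient s w x y"
      by (simp add: orient_def cross2_def algebra_simps)
    also have "\<dots> \<ge> 0" using yy gx3 D by simp
    finally have a: "0 \<le> orient s w p y" using gx2 by (simp add: zero_le_mult_iff)
    have "y \<noteq> p"
    proof
      assume "y = p"
      then have "0 \<le> orient s w x p" "0 \<le> orient s x u p" using yy by auto
      then show False
        using gx orient_cyclic[of s p x u] orient_swap[of s p x u] by linarith
    qed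
    then show "y \<in> tri p - {x}" using yy a sub by (auto simp: tri_def)
  qed
qed

section \<open>Linear functionals on the triangle and along the chain\<close>

lemma tri_inner_pos:
  assumes "apex p" "y \<in> tri p" "0 < (p - u) \<bullet> n" "0 < (w - u) \<bullet> n"
  shows "0 < (y - u) \<bullet> n"
proof -
  have "0 < orient s p u y" "0 \<le> orient s u w y" "0 < orient s u w p"
    using assms(1,2) tri_orient_pos[OF assms(1,2)] by (auto simp: tri_def apex_def)
  then have "0 < orient s u w p * ((y - u) \<bullet> n)"
    unfolding orient_barycentric[of s u w p y n] using assms(3,4) by (simp add: add_nonneg_pos)
  then show ?thesis
    using \<open>0 < orient s u w p\<close> by (simp add: zero_less_mult_iff)
qed

text \<open>\<open>y - u\<close> combines \<open>p - u\<close> and \<open>w - u\<close> with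
  nonnegative weights. The third barycentric coordinate is nonnegative as well, so these weights sum
  to at most 1 and the bound \<open>h\<close> survives.\<close>

lemma tri_inner_le:
  assumes "apex p" "y \<in> tri p" "(p - u) \<bullet> n \<le> h" "(w - u) \<bullet> n \<le> h" "0 \<le> h"
  shows "(y - u) \<bullet> n \<le> h"
proof -
  have pos: "0 \<le> orient s p u y" "0 \<le> orient s u w y" "0 \<le> orient s w p y" "0 < orient s u w p"
    using assms by (auto simp: tri_def apex_def)
  then have "orient s u w p * ((y - u) \<bullet> n) \<le> orient s u w y * h + orient s p u y * h"
    unfolding orient_barycentric[of s u w p y n] using assms(3,4) by (intro add_mono mult_left_mono) auto
  also have "\<dots> = (orient s u w y + orient s p u y) * h"
    by (simp add: distrib_right)
  also have "\<dots> \<le> orient s u w p * h"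
    using orient_barycentric_sum[of s u w y p] pos assms(5) by (intro mult_right_mono) linarith+
  finally show ?thesis using pos(4) by simp
qed

text \<open>The cross product splits into the oriented areas of \<open>w p x\<close> and
  \<open>p u x\<close>. Its positivity makes \<open>x - p\<close> and \<open>w - u\<close> a basis,
  as needed for Cramer's rule.\<close>

lemma wrap_step_cross_pos:
  assumes p: "apex p" and x: "wrap_step p x"
  shows "0 < s * cross2 (x - p) (w - u)"
proof -
  have xt: "x \<in> tri p" using x by (simp add: wrap_step_def)
  have "s * cross2 (x - p) (w - u) = orient s w p x + orient s p u x"
    by (simp add: orient_def cross2_def algebra_simps)
  moreover have "0 \<le> orient s w p x" "0 < orient s p u x"
    using xt tri_orient_pos[OF p xt] by (auto simp: tri_def)
  ultimately show ?thesis by simp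
qed

text \<open>The chain turns monotonically from \<open>x - p\<close> towards \<open>w - u\<close>.\<close>
lemma wrap_step_direction:
  assumes p: "apex p" and x: "wrap_step p x" and y: "y \<in> tri p"
    and q: "q = p \<or> q = x \<and> y \<in> tri x"
    and n: "0 \<le> (x - p) \<bullet> n" "0 \<le> (w - u) \<bullet> n"
  shows "0 \<le> (y - q) \<bullet> n"
proof -
  define E where "E = s * cross2 (x - p) (w - u)"
  have E: "0 < E" unfolding E_def by (rule wrap_step_cross_pos[OF p x])
  \<comment> \<open>Both coefficients of \<open>y - q\<close> in the basis \<open>x - p\<close>,
    \<open>w - u\<close> are nonnegative: one by the minimality of \<open>x\<close>, the other by
    membership in the triangle.\<close>
  have "E * ((y - q) \<bullet> n) = (s * cross2 (y - q) (w - u)) * ((x - p) \<bullet> n)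
      + (s * cross2 (x - p) (y - q)) * ((w - u) \<bullet> n)"
    unfolding E_def mult.assoc cross2_cramer[of "x - p" "w - u" "y - q" n] by (rule distrib_left)
  moreover have "s * cross2 (x - p) (y - q) = orient s p x y"
    using q by (auto simp: orient_def cross2_def algebra_simps)
  moreover have "0 \<le> orient s p x y" using x y by (auto simp: wrap_step_def)
  moreover have "s * cross2 (y - q) (w - u) = orient s w q y + orient s q u y"
    by (simp add: orient_def cross2_def algebra_simps)
  moreover have "0 \<le> orient s w q y + orient s q u y" using q y by (auto simp: tri_def)
  ultimately have "0 \<le> E * ((y - q) \<bullet> n)" using n by simp
  then show ?thesis using E by (simp add: zero_le_mult_iff)
qed

end

section \<open>Trigonometry of the cones\<close>

locale theta_trig =
  fixes k :: nat
  assumes k_pos: "k \<ge> 1"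
begin

section \<open>Estimates for the cone angle and the constant \<open>c\<close>\<close>

definition "N = 4 * k + 3"
definition "\<theta> = 2 * pi / real N"
definition "c = cos (\<theta> / 4) / (cos (\<theta> / 2) - sin (3 * \<theta> / 4))"

lemma N_\<theta>: "real N * \<theta> = 2 * pi"
  by (simp add: \<theta>_def N_def)

text \<open>This is how the remainder 3 of \<open>N\<close> modulo 4 enters the estimates: a quarter
  turn spans \<open>k\<close> cones and three quarters of another.\<close>

lemma pi_half: "pi / 2 = (real k + 3/4) * \<theta>"
  using N_\<theta> by (simp add: N_def algebra_simps)

lemma \<theta>_pos: "0 < \<theta>" by (simp add: \<theta>_def N_def)

lemma \<theta>_le: "\<theta> \<le> 2 * pi / 7"
  using k_pos unfolding \<theta>_def N_def by (intro divide_left_mono) auto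

lemma half_angle: "pi / real N = \<theta> / 2" by (simp add: \<theta>_def)

lemma cos_half_pos: "0 < cos (\<theta> / 2)"
  using \<theta>_pos \<theta>_le pi_gt_zero by (intro cos_gt_zero) linarith+

lemma tan_half_pos: "0 < tan (\<theta> / 2)"
  using \<theta>_pos \<theta>_le pi_gt_zero by (intro tan_gt_zero) linarith+

text \<open>The base of a canonical triangle is thus at most its height. With
  \<open>z = \<theta> / 2\<close> it is enough that \<open>2 * z\<close> is at most
  \<open>1 - z^2 / 2\<close>.\<close>

lemma tan_half_le: "2 * tan (\<theta> / 2) \<le> 1"
proof -
  define z where "z = \<theta> / 2"
  \<comment> \<open>The fraction slightly exceeds \<open>pi / 7\<close>; the final inequality leaves
    little room for a coarser one.\<close>
  have z: "0 < z" "z \<le> 4489 / 10000"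
    using \<theta>_pos \<theta>_le pi_approx unfolding z_def by auto
  have "sin z \<le> z" using z by (intro sin_x_le_x) simp
  have "cos z = 1 - 2 * (sin (z / 2))\<^sup>2"
    using cos_double_sin[of "z / 2"] by simp
  moreover have "(sin (z / 2))\<^sup>2 \<le> (z / 2)\<^sup>2"
    using z pi_gt3 by (intro power_mono sin_x_le_x sin_ge_zero) auto
  ultimately have "cos z \<ge> 1 - z\<^sup>2 / 2" by (simp add: power2_eq_square)
  moreover have "z\<^sup>2 \<le> (4489 / 10000)\<^sup>2" using z by (intro power_mono) auto
  ultimately have "2 * sin z \<le> cos z"
    using \<open>sin z \<le> z\<close> z by (simp add: power2_eq_square)
  then show ?thesis
    using cos_half_pos unfolding tan_def z_def by simp
qed

text \<open>Product formulas for the angles \<open>?s\<close> and \<open>?r\<close>, whose sum is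
  \<open>pi / 2\<close> and difference \<open>\<theta> / 4\<close>; the common factor
  \<open>2 * sin ?r\<close> cancels.\<close>

lemma c_eq: "c = sin (pi / 4 + \<theta> / 8) / cos (pi / 4 + \<theta> / 8 + \<theta> / 2)"
  and c_denominator_pos: "0 < cos (pi / 4 + \<theta> / 8 + \<theta> / 2)"
proof -
  let ?s = "pi / 4 + \<theta> / 8" and ?r = "pi / 4 - \<theta> / 8"
  have "cos (\<theta> / 4) = cos (?s - ?r) - cos (?s + ?r)" by simp
  then have 1: "cos (\<theta> / 4) = 2 * sin ?s * sin ?r" unfolding cos_diff[of ?s ?r] cos_add[of ?s ?r] by simp
  have "cos (\<theta> / 2) = sin ((?s + \<theta> / 2) + ?r)" by (simp add: sin_cos_eq)
  moreover have "(3 * \<theta> / 4) = (?s + \<theta> / 2) - ?r" by simp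
  ultimately have "cos (\<theta> / 2) - sin (3 * \<theta> / 4) = sin ((?s + \<theta> / 2) + ?r) - sin ((?s + \<theta> / 2) - ?r)"
    by metis
  then have 2: "cos (\<theta> / 2) - sin (3 * \<theta> / 4) = 2 * cos (?s + \<theta> / 2) * sin ?r"
    unfolding sin_diff[of "?s + \<theta> / 2" ?r] sin_add[of "?s + \<theta> / 2" ?r] by simp
  have "0 < sin ?r" using \<theta>_pos \<theta>_le pi_gt_zero by (intro sin_gt_zero) linarith+
  then show "c = sin ?s / cos (?s + \<theta> / 2)"
    unfolding c_def 1 2 by simp
  show "0 < cos (?s + \<theta> / 2)"
    using \<theta>_pos \<theta>_le pi_gt_zero by (intro cos_gt_zero) linarith+
qed

lemma c_ge_1: "1 \<le> c"
proof -
  have "cos (pi / 4 + \<theta> / 8 + \<theta> / 2) = sin (pi / 2 - (pi / 4 + \<theta> / 8 + \<theta> / 2))"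
    by (simp only: sin_cos_eq) (simp add: add.commute)
  also have "\<dots> \<le> sin (pi / 4 + \<theta> / 8)"
    using \<theta>_pos \<theta>_le pi_gt_zero by (intro sin_monotone_2pi_le) linarith+
  finally show ?thesis using c_denominator_pos by (simp add: c_eq)
qed

definition G :: "real \<Rightarrow> real" where
  "G x = cos x / cos (\<theta> / 2) + c * (cos x * tan (\<theta> / 2) + sin x)"

text \<open>\<open>r * G \<psi>\<close> is the bound \<open>L\<close> below on a step of length \<open>r\<close> at angle \<open>\<psi>\<close> to the bisector. The value of
  \<open>c\<close> is the one for which the sinusoid \<open>G\<close> agrees at \<open>\<theta> / 4\<close> and \<open>pi / 2\<close>, so that it is symmetric
  about \<open>pi / 4 + \<theta> / 8\<close>.\<close>
lemma G_mono:
  assumes "0 \<le> a" "a \<le> b" "a + b \<le> pi / 2 + \<theta> / 4"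
  shows "G a \<le> G b"
proof -
  define m where "m = (a + b) / 2"
  define r where "r = (b - a) / 2"
  have ab: "a = m - r" "b = m + r" by (auto simp: m_def r_def field_simps)
  have m: "0 \<le> m" "m \<le> pi / 4 + \<theta> / 8" using assms by (auto simp: m_def)
  have r: "0 \<le> sin r" using assms \<theta>_le pi_gt_zero by (intro sin_ge_zero) (auto simp: r_def)
  \<comment> \<open>Up to a positive factor, \<open>c * cos (m + \<theta> / 2) - sin m\<close> is
    the derivative of \<open>G\<close> at the midpoint \<open>m\<close>. By \<open>c_eq\<close> it
    vanishes at \<open>pi / 4 + \<theta> / 8\<close>, and \<open>m\<close> is not beyond
    that.\<close>
  have "sin m * cos (pi / 4 + \<theta> / 8 + \<theta> / 2) \<le> sin (pi / 4 + \<theta> / 8) * cos (m + \<theta> / 2)"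
  proof (rule mult_mono)
    show "sin m \<le> sin (pi / 4 + \<theta> / 8)"
      using m \<theta>_le pi_gt_zero by (intro sin_monotone_2pi_le) linarith+
    show "cos (pi / 4 + \<theta> / 8 + \<theta> / 2) \<le> cos (m + \<theta> / 2)"
      using m \<theta>_pos \<theta>_le pi_gt_zero by (intro cos_monotone_0_pi_le) linarith+
    show "0 \<le> sin (pi / 4 + \<theta> / 8)"
      using \<theta>_pos \<theta>_le pi_gt_zero by (intro sin_ge_zero) linarith+
    show "0 \<le> cos (pi / 4 + \<theta> / 8 + \<theta> / 2)" using c_denominator_pos by simp
  qed
  then have key: "sin m \<le> c * cos (m + \<theta> / 2)"
    using c_denominator_pos by (simp add: c_eq pos_le_divide_eq)
  have G_alt: "cos (\<theta> / 2) * G x = cos x + c * sin (x + \<theta> / 2)" for x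
    using cos_half_pos unfolding G_def tan_def sin_add[of x "\<theta> / 2"] by (simp add: field_simps)
  have "cos (\<theta> / 2) * (G b - G a) = cos (m + r) - cos (m - r) + c * (sin (m + \<theta> / 2 + r) - sin (m + \<theta> / 2 - r))"
    using G_alt[of a] G_alt[of b] by (simp add: ab algebra_simps)
  also have "\<dots> = 2 * sin r * (c * cos (m + \<theta> / 2) - sin m)"
    unfolding cos_add[of m r] cos_diff[of m r] sin_add[of "m + \<theta> / 2" r] sin_diff[of "m + \<theta> / 2" r]
    by (simp add: algebra_simps)
  also have "\<dots> \<ge> 0" using key r by simp
  finally show ?thesis using cos_half_pos by (simp add: zero_le_mult_iff)
qed

section \<open>Integer cone labels modulo \<open>N\<close> and polar coordinates\<close>

definition cone_index :: "int \<Rightarrow> nat" where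
  "cone_index m = nat (m mod int N)"

lemma cone_index_less: "cone_index m < N"
  by (simp add: cone_index_def N_def nat_less_iff)

lemma cone_index_angle:
  "sin (real (cone_index m) * \<theta> + \<phi>) = sin (real_of_int m * \<theta> + \<phi>)"
  "cos (real (cone_index m) * \<theta> + \<phi>) = cos (real_of_int m * \<theta> + \<phi>)"
proof -
  have "int (cone_index m) = m - int N * (m div int N)"
    by (simp add: cone_index_def N_def minus_mult_div_eq_mod)
  then have "real (cone_index m) = real_of_int m - real N * of_int (m div int N)"
    by (metis of_int_diff of_int_mult of_int_of_nat_eq)
  then have "real (cone_index m) * \<theta> = real_of_int m * \<theta> - real N * \<theta> * of_int (m div int N)"
    by (metis (no_types, lifting) left_diff_distrib mult.assoc mult.commute)
  then have "real (cone_index m) * \<theta> + \<phi> = (real_of_int m * \<theta> + \<phi>) - (2 * pi) * of_int (m div int N)"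
    unfolding N_\<theta> by simp
  then show "sin (real (cone_index m) * \<theta> + \<phi>) = sin (real_of_int m * \<theta> + \<phi>)"
    "cos (real (cone_index m) * \<theta> + \<phi>) = cos (real_of_int m * \<theta> + \<phi>)"
    by (simp_all only: sin_diff[of _ "2 * pi * _"] cos_diff[of _ "2 * pi * _"]) simp_all
qed

text \<open>Angles run clockwise from the upward vertical, as in \<open>cone_dir\<close>, hence the
  sine comes first; passing to another cone subtracts a multiple of \<open>\<theta>\<close>.\<close>

lemma proj_offs_polar:
  assumes "x - p = (r * sin a, r * cos a)"
  shows "proj N (cone_index m) p x = r * cos (a - m * \<theta>)" "offs N (cone_index m) p x = r * sin (a - m * \<theta>)"
  using cone_index_angle[of m 0] unfolding proj_def offs_def assms cone_dir_def cone_perp_def \<theta>_def[symmetric]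
  by (simp_all add: cos_diff sin_diff right_diff_distrib distrib_left)

lemma dist_offs_proj: "(dist u v)\<^sup>2 = (offs N i u v)\<^sup>2 + (proj N i u v)\<^sup>2"
proof -
  obtain d1 d2 where d: "v - u = (d1, d2)" by fastforce
  define C where "C = cos (real i * \<theta>)"
  define Z where "Z = sin (real i * \<theta>)"
  have "Z\<^sup>2 + C\<^sup>2 = 1" by (simp add: C_def Z_def)
  then have "d1\<^sup>2 + d2\<^sup>2 = (d1 * C - d2 * Z)\<^sup>2 + (d1 * Z + d2 * C)\<^sup>2" by algebra
  moreover have "(dist u v)\<^sup>2 = d1\<^sup>2 + d2\<^sup>2"
    using d by (simp add: dist_norm norm_minus_commute[of u v] norm_Pair)
  ultimately show ?thesis
    unfolding offs_def proj_def d cone_perp_def cone_dir_def \<theta>_def[symmetric] C_def Z_def by simp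
qed

end

section \<open>Paths and single steps\<close>

definition reach :: "(pt \<Rightarrow> pt \<Rightarrow> bool) \<Rightarrow> pt \<Rightarrow> pt \<Rightarrow> real \<Rightarrow> bool" where
  "reach E u w B \<longleftrightarrow> (\<exists>xs. is_path E xs u w \<and> path_length xs \<le> B)"

lemma reach_mono: "reach E u w B \<Longrightarrow> B \<le> B' \<Longrightarrow> reach E u w B'"
  unfolding reach_def by force

lemma path_length_Cons: "path_length (x # y # zs) = dist x y + path_length (y # zs)"
  unfolding path_length_def by (simp add: sum.lessThan_Suc_shift del: sum.lessThan_Suc)

lemma is_path_Cons:
  "is_path E (x # y # zs) u w \<longleftrightarrow> x = u \<and> E x y \<and> is_path E (y # zs) y w"
proof -
  have "(\<forall>j. Suc j < length (x # y # zs) \<longrightarrow> E ((x # y # zs) ! j) ((x # y # zs) ! Suc j)) \<longleftrightarrow>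
      E x y \<and> (\<forall>j. Suc j < length (y # zs) \<longrightarrow> E ((y # zs) ! j) ((y # zs) ! Suc j))"
    (is "?l \<longleftrightarrow> ?r")
  proof
    assume ?l
    then show ?r by (metis Suc_less_eq length_Cons nth_Cons_0 nth_Cons_Suc zero_less_Suc)
  next
    assume r: ?r
    show ?l
    proof (intro allI impI)
      fix j assume "Suc j < length (x # y # zs)"
      then show "E ((x # y # zs) ! j) ((x # y # zs) ! Suc j)"
        using r by (cases j) auto
    qed
  qed
  then show ?thesis unfolding is_path_def by auto
qed

lemma reach_edge: "E u w \<Longrightarrow> dist u w \<le> B \<Longrightarrow> reach E u w B"
  unfolding reach_def
  by (intro exI[of _ "[u, w]"]) (simp add: is_path_def path_length_def)

lemma reach_trans:
  assumes "reach E a b B1" "reach E b d B2"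
  shows "reach E a d (B1 + B2)"
proof -
  obtain ys where ys: "is_path E ys b d" "path_length ys \<le> B2"
    using assms(2) by (auto simp: reach_def)
  have "reach E a d (path_length xs + B2)" if "is_path E xs a b" for xs
    using that
  proof (induction xs arbitrary: a)
    case Nil
    then show ?case by (simp add: is_path_def)
  next
    case (Cons x xs)
    show ?case
    proof (cases xs)
      case Nil
      then have "a = b" using Cons.prems by (auto simp: is_path_def)
      then show ?thesis using ys Nil by (auto simp: reach_def path_length_def)
    next
      case (Cons y zs)
      with Cons.prems have x: "x = a" "E a y" "is_path E xs y b" by (auto simp: is_path_Cons)
      from Cons.IH[OF x(3)] obtain qs where qs: "is_path E qs y d" "path_length qs \<le> path_length xs + B2"
        by (auto simp: reach_def)
      then obtain rs where "qs = y # rs" by (cases qs) (auto simp: is_path_def)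
      then have "is_path E (a # qs) a d" "path_length (a # qs) \<le> path_length (x # xs) + B2"
        using qs x Cons by (auto simp: is_path_Cons path_length_Cons)
      then show ?thesis by (auto simp: reach_def)
    qed
  qed
  then show ?thesis
    using assms(1) reach_mono unfolding reach_def[of E a b] by (meson add_right_mono)
qed

section \<open>The cost of one step in different cones\<close>

locale theta_config = theta_trig k + constrained_points P S for k P S +
  assumes gp: "general_position N P"
begin

text \<open>The first summand is the length of a side of the canonical triangle at \<open>a\<close>;
  the factor of \<open>c\<close> is the larger of the distances from \<open>b\<close> to the other
  two corners.\<close>

definition bound :: "nat \<Rightarrow> pt \<Rightarrow> pt \<Rightarrow> real" where
  "bound j a b = proj N j a b / cos (\<theta> / 2) + c * (proj N j a b * tan (\<theta> / 2) + \<bar>offs N j a b\<bar>)"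

lemma proj_nonzero: "\<lbrakk>a \<in> P; b \<in> P; a \<noteq> b; j < N\<rbrakk> \<Longrightarrow> proj N j a b \<noteq> 0"
  using gp unfolding general_position_def proj_def by blast

text \<open>General position speaks of the rays \<open>0\<close> to \<open>N - 1\<close>; reduction
  modulo \<open>N\<close> extends it to every integer label.\<close>

lemma polar_not_on_ray:
  assumes "p \<in> P" "x \<in> P" "p \<noteq> x" "x - p = (r * sin a, r * cos a)"
  shows "a \<noteq> real_of_int n * \<theta> + \<theta> / 2"
proof
  assume a: "a = real_of_int n * \<theta> + \<theta> / 2"
  have "ray_dir N (cone_index n) = (sin a, cos a)"
    using cone_index_angle[of n "\<theta> / 2"] unfolding ray_dir_def half_angle a \<theta>_def[symmetric] by simp
  then have "cross2 (x - p) (ray_dir N (cone_index n)) = 0"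
    by (simp add: assms(4) cross2_def)
  then show False
    using gp cone_index_less assms(1-3) unfolding general_position_def by blast
qed

text \<open>Cone \<open>j\<close> lies \<open>m\<close> positions from cone \<open>i\<close> on the side given by \<open>sg\<close>.\<close>
lemma step_cone:
  assumes P: "p \<in> P" "x \<in> P" "p \<noteq> x" and sg: "sg = 1 \<or> sg = (-1::int)"
    and X_def: "X = sg * offs N i p x" and Y_def: "Y = proj N i p x"
    and Y: "0 < Y" and X: "Y * tan (\<theta> / 2) \<le> X"
  shows "\<exists>j m. 1 \<le> m \<and> m \<le> k + 1 \<and> in_cone N p j x
    \<and> proj N j p x = X * sin (real m * \<theta>) + Y * cos (real m * \<theta>)
    \<and> bound j p x \<le> Y / cos (\<theta> / 2) + c * (X + Y * tan (\<theta> / 2))"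
proof -
  \<comment> \<open>\<open>\<psi>\<close> is the angle of the step from the bisector of cone
    \<open>i\<close> towards the side \<open>sg\<close>, and \<open>r\<close> is its length.\<close>
  define \<psi> where "\<psi> = arctan (X / Y)"
  define r where "r = Y / cos \<psi>"
  have \<psi>: "\<psi> < pi / 2" "\<theta> / 2 \<le> \<psi>"
  proof -
    show "\<psi> < pi / 2" unfolding \<psi>_def by (rule arctan_ubound)
    have "tan (\<theta> / 2) \<le> X / Y" using X Y by (simp add: field_simps)
    then have "arctan (tan (\<theta> / 2)) \<le> \<psi>" by (simp add: \<psi>_def arctan_monotone')
    then show "\<theta> / 2 \<le> \<psi>" using \<theta>_pos \<theta>_le pi_gt_zero by (subst (asm) arctan_tan) linarith+
  qed
  have cos_\<psi>: "0 < cos \<psi>" using \<psi> \<theta>_pos by (intro cos_gt_zero) linarith+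
  have r: "0 < r" "Y = r * cos \<psi>" using Y cos_\<psi> by (auto simp: r_def)
  have Xr: "X = r * sin \<psi>"
  proof -
    have "tan \<psi> = X / Y" by (simp add: \<psi>_def tan_arctan)
    then show ?thesis using r cos_\<psi> Y by (simp add: tan_def field_simps)
  qed
  define a where "a = real i * \<theta> + sg * \<psi>"
  have sq: "(cos (real i * \<theta>))\<^sup>2 + (sin (real i * \<theta>))\<^sup>2 = 1" by simp
  have polar: "x - p = (r * sin a, r * cos a)"
  proof -
    obtain d1 d2 where d: "x - p = (d1, d2)" by fastforce
    have o: "offs N i p x = sg * X" using sg X_def by auto
    have e1: "d1 * cos (real i * \<theta>) - d2 * sin (real i * \<theta>) = sg * r * sin \<psi>"
      using o unfolding offs_def d cone_perp_def \<theta>_def[symmetric] Xr by simp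
    have e2: "d1 * sin (real i * \<theta>) + d2 * cos (real i * \<theta>) = r * cos \<psi>"
      using Y_def unfolding proj_def d cone_dir_def \<theta>_def[symmetric] r(2) by simp
    have "sin (sg * \<psi>) = sg * sin \<psi>" "cos (sg * \<psi>) = cos \<psi>" using sg by auto
    then have "r * sin a = r * cos \<psi> * sin (real i * \<theta>) + sg * r * sin \<psi> * cos (real i * \<theta>)"
      "r * cos a = r * cos \<psi> * cos (real i * \<theta>) - sg * r * sin \<psi> * sin (real i * \<theta>)"
      unfolding a_def sin_add cos_add by (simp_all add: algebra_simps)
    then have "r * sin a = d1 * ((cos (real i * \<theta>))\<^sup>2 + (sin (real i * \<theta>))\<^sup>2)"
      "r * cos a = d2 * ((cos (real i * \<theta>))\<^sup>2 + (sin (real i * \<theta>))\<^sup>2)"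
      using e1 e2 by algebra+
    then show ?thesis unfolding sq d by simp
  qed
  \<comment> \<open>The integer nearest to \<open>\<psi> / \<theta>\<close> counts the cones from
    cone \<open>i\<close> to the one containing the step.\<close>
  define M where "M = \<lfloor>\<psi> / \<theta> + 1/2\<rfloor>"
  have "real_of_int M \<le> \<psi> / \<theta> + 1/2" "\<psi> / \<theta> + 1/2 < real_of_int M + 1"
    unfolding M_def by linarith+
  then have M: "real_of_int M * \<theta> - \<theta> / 2 \<le> \<psi>" "\<psi> < real_of_int M * \<theta> + \<theta> / 2"
    using \<theta>_pos by (simp_all add: field_simps)
  have "1 \<le> M" 
  proof -
    have "1/2 \<le> \<psi> / \<theta>" using \<psi> \<theta>_pos by (simp add: field_simps)
    then show ?thesis unfolding M_def by linarith
  qed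
  moreover have "M \<le> int k + 1"
  proof -
    have "\<psi> / \<theta> < real k + 3/4" using \<psi>(1) \<theta>_pos unfolding pi_half by (simp add: field_simps)
    then show ?thesis unfolding M_def by linarith
  qed
  ultimately obtain m where m: "M = int m" "1 \<le> m" "m \<le> k + 1"
    by (metis of_nat_1 of_nat_add zero_le_imp_eq_int of_nat_le_iff order_trans zero_le_one)
  define \<phi> where "\<phi> = \<bar>\<psi> - real m * \<theta>\<bar>"
  define j where "j = cone_index (int i + sg * int m)"
  have "\<psi> \<noteq> real m * \<theta> - \<theta> / 2"
  proof
    assume e: "\<psi> = real m * \<theta> - \<theta> / 2"
    \<comment> \<open>Ray \<open>n\<close> separates cones \<open>n\<close> and
      \<open>n + 1\<close>, so the boundary on the near side carries the index of the cone itself or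
      one less, depending on \<open>sg\<close>.\<close>
    have "a = real_of_int (int i + sg * int m - (sg + 1) div 2) * \<theta> + \<theta> / 2"
      using sg unfolding a_def e by (auto simp: algebra_simps)
    then show False using polar_not_on_ray[OF P polar] by blast
  qed
  then have \<phi>: "0 \<le> \<phi>" "\<phi> < \<theta> / 2"
    using M unfolding \<phi>_def m(1) of_int_of_nat_eq by (simp, linarith)
  have am: "a - (int i + sg * int m) * \<theta> = sg * (\<psi> - real m * \<theta>)"
    by (simp add: a_def algebra_simps)
  have pr: "proj N j p x = r * cos (\<psi> - real m * \<theta>)"
    using proj_offs_polar(1)[OF polar, of "int i + sg * int m"] sg unfolding am j_def
    by (auto simp: cos_minus[of "\<psi> - real m * \<theta>", symmetric] simp del: cos_minus)
  have pr\<phi>: "proj N j p x = r * cos \<phi>" unfolding pr \<phi>_def by (rule arg_cong[of _ _ "\<lambda>z. r * z"]) (rule cos_abs_real[symmetric])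
  have of\<phi>: "\<bar>offs N j p x\<bar> = r * sin \<phi>"
  proof -
    have "offs N j p x = r * sin (sg * (\<psi> - real m * \<theta>))"
      using proj_offs_polar(2)[OF polar, of "int i + sg * int m"] unfolding am j_def .
    moreover have "sin (sg * z) = sin \<bar>z\<bar> \<or> sin (sg * z) = - sin \<bar>z\<bar>" for z :: real
      using sg by (auto simp: abs_if)
    ultimately have "offs N j p x = r * sin \<phi> \<or> offs N j p x = - (r * sin \<phi>)"
      unfolding \<phi>_def by (metis mult_minus_right)
    moreover have "0 \<le> sin \<phi>" using \<phi> \<theta>_le pi_gt_zero by (intro sin_ge_zero) linarith+
    ultimately show ?thesis using r(1) by (auto simp: abs_mult)
  qed
  have "in_cone N p j x"
    unfolding in_cone_def
  proof (intro conjI)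
    show "j < N" by (simp add: j_def cone_index_less)
    show "0 < proj N j p x"
      unfolding pr\<phi> using r(1) \<phi> \<theta>_le pi_gt_zero by (intro mult_pos_pos cos_gt_zero_pi) linarith+
    have "0 < sin (\<theta> / 2 - \<phi>)" using \<phi> \<theta>_le pi_gt_zero by (intro sin_gt_zero) linarith+
    then have "sin \<phi> < cos \<phi> * tan (\<theta> / 2)"
      using cos_half_pos unfolding sin_diff tan_def by (simp add: field_simps)
    then show "\<bar>offs N j p x\<bar> < proj N j p x * tan (pi / real N)"
      unfolding of\<phi> pr\<phi> half_angle using r(1) by simp
  qed
  moreover have "proj N j p x = X * sin (real m * \<theta>) + Y * cos (real m * \<theta>)"
    unfolding pr Xr r(2) cos_diff by (simp add: algebra_simps)
  moreover have "bound j p x \<le> Y / cos (\<theta> / 2) + c * (X + Y * tan (\<theta> / 2))"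
  proof -
    have mk: "real m * \<theta> \<le> (real k + 1) * \<theta>" using m(3) \<theta>_pos by (intro mult_right_mono) auto
    have "\<phi> \<le> \<psi>" using \<phi> \<psi> by simp
    \<comment> \<open>Before the bisector of cone \<open>j\<close> the sum is
      \<open>m * \<theta>\<close>, at most
      \<open>(k + 1) * \<theta> = pi / 2 + \<theta> / 4\<close>. Past it \<open>m\<close> is at most
      \<open>k\<close>, because \<open>(k + 1) * \<theta>\<close> exceeds a right angle.\<close>
    moreover have "\<phi> + \<psi> \<le> pi / 2 + \<theta> / 4"
    proof (cases "\<psi> \<le> real m * \<theta>")
      case True
      then show ?thesis using mk unfolding pi_half \<phi>_def by (simp add: algebra_simps)
    next
      case False
      have "m \<noteq> k + 1"
      proof
        assume "m = k + 1"
        then have "real m * \<theta> = real k * \<theta> + \<theta>" by (simp add: algebra_simps)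
        then show False using False \<psi>(1) \<theta>_pos unfolding pi_half by (simp add: algebra_simps)
      qed
      then have "real m * \<theta> \<le> real k * \<theta>" using m(3) \<theta>_pos by (intro mult_right_mono) auto
      moreover have "\<phi> = \<psi> - real m * \<theta>" using False by (simp add: \<phi>_def)
      ultimately show ?thesis using M(2) unfolding m(1) of_int_of_nat_eq pi_half distrib_right by linarith
    qed
    ultimately have "G \<phi> \<le> G \<psi>" using \<phi>(1) by (intro G_mono)
    then have "r * G \<phi> \<le> r * G \<psi>" using r(1) by simp
    then show ?thesis
      unfolding bound_def of\<phi> pr\<phi> Xr r(2) G_def by (simp add: algebra_simps)
  qed
  ultimately show ?thesis using m(2,3) by blast
qed

end

section \<open>One sector of the graph\<close>

text \<open>\<open>sg\<close> selects the side of \<open>uw\<close> on which the chain runs.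
  \<open>IH\<close> is the hypothesis of the outer induction; it covers smaller canonical triangles
  in every cone, since a step may leave cone \<open>i\<close>.\<close>

locale theta_sector = theta_config k P S + visibility_triangle P S u w "real_of_int sg"
  for k P S u w sg +
  fixes i :: nat
  assumes sg: "sg = 1 \<or> sg = -1"
    and w_cone: "in_cone N u i w"
    and IH: "\<lbrakk>a \<in> P; b \<in> P; sees S a b; in_cone N a j b; proj N j a b < proj N i u w\<rbrakk>
      \<Longrightarrow> reach (theta_edge P S N) a b (bound j a b)"
begin

text \<open>Coordinates in the frame of cone \<open>i\<close>, reflected if \<open>sg = -1\<close>,
  so that every apex lies to the left of \<open>uw\<close>, the side of smaller
  \<open>X / Y\<close>.\<close>

definition X :: "pt \<Rightarrow> real" where "X d = sg * (d \<bullet> cone_perp N i)"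
definition Y :: "pt \<Rightarrow> real" where "Y d = d \<bullet> cone_dir N i"

text \<open>\<open>L d\<close> is the length of the detour from \<open>0\<close> to \<open>d\<close> parallel to the left side of the canonical triangle
  and then parallel to its base, the second part weighted by \<open>c\<close>; being linear, it telescopes along
  the chain. \<open>R\<close> is its mirror image.\<close>
definition L :: "pt \<Rightarrow> real" where "L d = Y d / cos (\<theta> / 2) + c * (X d + Y d * tan (\<theta> / 2))"
definition R :: "pt \<Rightarrow> real" where "R d = Y d / cos (\<theta> / 2) + c * (- X d + Y d * tan (\<theta> / 2))"

lemma XY_diff: "X (a - b) = X a - X b" "Y (a - b) = Y a - Y b"
  by (simp_all add: X_def Y_def inner_diff_left algebra_simps)

lemma LR_diff: "L (a - b) = L a - L b" "R (a - b) = R a - R b"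
  unfolding L_def R_def XY_diff by (simp_all add: diff_divide_distrib algebra_simps)

lemma offs_proj_XY: "sg * offs N i a b = X (b - a)" "\<bar>offs N i a b\<bar> = \<bar>X (b - a)\<bar>" "proj N i a b = Y (b - a)"
  using sg by (auto simp: X_def Y_def offs_def proj_def)

lemma cross2_XY: "sg * cross2 a b = X a * Y b - Y a * X b"
proof -
  obtain a1 a2 b1 b2 where ab: "a = (a1, a2)" "b = (b1, b2)" by fastforce
  define C where "C = cos (real i * \<theta>)"
  define Z where "Z = sin (real i * \<theta>)"
  have "Z\<^sup>2 + C\<^sup>2 = 1" by (simp add: C_def Z_def)
  then have "a1 * b2 - a2 * b1 = (a1 * C - a2 * Z) * (b1 * Z + b2 * C) - (a1 * Z + a2 * C) * (b1 * C - b2 * Z)"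
    by algebra
  then have "cross2 a b = (a \<bullet> cone_perp N i) * (b \<bullet> cone_dir N i) - (a \<bullet> cone_dir N i) * (b \<bullet> cone_perp N i)"
    unfolding cone_perp_def cone_dir_def \<theta>_def[symmetric] ab cross2_def C_def Z_def by simp
  then show ?thesis by (simp add: X_def Y_def right_diff_distrib mult.assoc mult.left_commute)
qed

lemma i_less: "i < N" using w_cone by (simp add: in_cone_def)

text \<open>The canonical triangle of \<open>u\<close> and \<open>w\<close>, open along the two
  sides at \<open>u\<close> and closed along the base.\<close>

definition inside :: "pt \<Rightarrow> bool" where
  "inside y \<longleftrightarrow> 0 < Y (y - u) \<and> \<bar>X (y - u)\<bar> < Y (y - u) * tan (\<theta> / 2) \<and> Y (y - u) \<le> Y (w - u)"

lemma in_cone_iff: "in_cone N a i b \<longleftrightarrow> 0 < Y (b - a) \<and> \<bar>X (b - a)\<bar> < Y (b - a) * tan (\<theta> / 2)"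
  unfolding in_cone_def offs_proj_XY half_angle using i_less by auto

lemma inside_iff: "inside y \<longleftrightarrow> in_cone N u i y \<and> proj N i u y \<le> proj N i u w"
  unfolding inside_def in_cone_iff offs_proj_XY by simp

lemma w_inside: "inside w" using w_cone by (simp add: inside_iff)

text \<open>Convexity of the canonical triangle: each of its bounding lines is a linear functional
  to which \<open>tri_inner_pos\<close> or \<open>tri_inner_le\<close> applies.\<close>

lemma tri_inside:
  assumes "apex p" "inside p" "y \<in> tri p"
  shows "inside y"
proof -
  have t: "Y d * tan (\<theta> / 2) + X d = d \<bullet> (tan (\<theta> / 2) *\<^sub>R cone_dir N i + real_of_int sg *\<^sub>R cone_perp N i)"
    "Y d * tan (\<theta> / 2) - X d = d \<bullet> (tan (\<theta> / 2) *\<^sub>R cone_dir N i - real_of_int sg *\<^sub>R cone_perp N i)" for d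
    by (simp_all add: X_def Y_def inner_add_right inner_diff_right)
  have p: "0 < Y (p - u)" "0 < Y (p - u) * tan (\<theta> / 2) + X (p - u)" "0 < Y (p - u) * tan (\<theta> / 2) - X (p - u)"
    "Y (p - u) \<le> Y (w - u)"
    using assms(2) by (auto simp: inside_def abs_less_iff)
  have w: "0 < Y (w - u)" "0 < Y (w - u) * tan (\<theta> / 2) + X (w - u)" "0 < Y (w - u) * tan (\<theta> / 2) - X (w - u)"
    using w_inside by (auto simp: inside_def abs_less_iff)
  have "0 < Y (y - u)" "Y (y - u) \<le> Y (w - u)"
    using tri_inner_pos[OF assms(1,3), of "cone_dir N i"] tri_inner_le[OF assms(1,3), of "cone_dir N i" "Y (w - u)"] p w
    by (auto simp: Y_def)
  moreover have "0 < Y (y - u) * tan (\<theta> / 2) + X (y - u)"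
    unfolding t(1) using p(2) w(2) unfolding t(1) by (rule tri_inner_pos[OF assms(1,3)])
  moreover have "0 < Y (y - u) * tan (\<theta> / 2) - X (y - u)"
    unfolding t(2) using p(3) w(3) unfolding t(2) by (rule tri_inner_pos[OF assms(1,3)])
  ultimately show ?thesis by (auto simp: inside_def abs_less_iff)
qed

section \<open>Single steps inside the canonical triangle\<close>

lemma step_in_cone:
  assumes "p \<in> P" "x \<in> P" "inside p" "inside x" "sees S p x" "0 < Y (x - p)"
    and "\<bar>X (x - p)\<bar> < Y (x - p) * tan (\<theta> / 2)"
  shows "reach (theta_edge P S N) p x (Y (x - p) / cos (\<theta> / 2) + c * (\<bar>X (x - p)\<bar> + Y (x - p) * tan (\<theta> / 2)))"
proof -
  have "in_cone N p i x" using assms by (simp add: in_cone_iff)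
  \<comment> \<open>The height of the step is a difference of heights above \<open>u\<close>, and
    \<open>p\<close> is strictly above \<open>u\<close>.\<close>
  moreover have "proj N i p x < proj N i u w"
    using assms(3,4) unfolding offs_proj_XY inside_def XY_diff by linarith
  ultimately have "reach (theta_edge P S N) p x (bound i p x)" using IH assms by blast
  then show ?thesis unfolding bound_def offs_proj_XY by (simp add: add.commute)
qed

text \<open>When the step leaves cone \<open>i\<close>, \<open>step_cone\<close> bounds its cost by
  \<open>L\<close>. It remains to see that its canonical triangle in the other cone is lower than
  that of \<open>uw\<close>.\<close>

lemma step_right:
  assumes "p \<in> P" "x \<in> P" "inside p" "inside x" "sees S p x" "0 < Y (x - p)" "0 \<le> X (x - p)"
  shows "reach (theta_edge P S N) p x (L (x - p))"
proof (cases "X (x - p) < Y (x - p) * tan (\<theta> / 2)")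
  case True
  then show ?thesis
    using step_in_cone[of p x] assms unfolding L_def by simp
next
  case False
  have "p \<noteq> x" using assms(6) by (auto simp: Y_def)
  obtain j m where m: "1 \<le> m" "m \<le> k + 1" and j: "in_cone N p j x"
    "proj N j p x = X (x - p) * sin (real m * \<theta>) + Y (x - p) * cos (real m * \<theta>)"
    "bound j p x \<le> L (x - p)"
    using step_cone[OF assms(1,2) \<open>p \<noteq> x\<close> sg, of "X (x - p)" i "Y (x - p)"] False assms(6)
    unfolding L_def offs_proj_XY by auto
  define \<beta> where "\<beta> = real m * \<theta>"
  define h where "h = Y (w - u)"
  define t where "t = tan (\<theta> / 2)"
  have t: "0 < t" "2 * t \<le> 1" using tan_half_pos tan_half_le by (auto simp: t_def)
  have p: "0 < Y (p - u)" "- (Y (p - u) * t) < X (p - u)" "Y (p - u) \<le> h"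
    using assms(3) unfolding inside_def h_def t_def by linarith+
  have x: "0 < Y (x - u)" "X (x - u) < Y (x - u) * t" "Y (x - u) \<le> h"
    using assms(4) unfolding inside_def h_def t_def by linarith+
  have d: "X (x - p) = X (x - u) - X (p - u)" "Y (x - p) = Y (x - u) - Y (p - u)"
    by (simp_all add: XY_diff)
  have \<beta>1: "\<theta> \<le> \<beta>" using m(1) \<theta>_pos by (simp add: \<beta>_def)
  have \<beta>2: "\<beta> \<le> (real k + 1) * \<theta>"
    unfolding \<beta>_def using m(2) \<theta>_pos by (intro mult_right_mono) auto
  then have \<beta>3: "\<beta> \<le> pi / 2 + \<theta> / 4" unfolding pi_half by (simp add: algebra_simps)
  have sin\<beta>: "0 < sin \<beta>" using \<beta>1 \<beta>3 \<theta>_pos \<theta>_le pi_gt_zero by (intro sin_gt_zero) linarith+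
  have "proj N j p x < h"
  proof (cases "m = k + 1")
    case True
    \<comment> \<open>The other bisector now points slightly downwards, so the height is at most the
      width of the step, which is less than the base.\<close>
    then have "\<beta> = pi / 2 + \<theta> / 4" unfolding \<beta>_def pi_half by (simp add: algebra_simps)
    then have "cos \<beta> = - sin (\<theta> / 4)" by (simp add: cos_add)
    moreover have "0 \<le> sin (\<theta> / 4)" using \<theta>_pos \<theta>_le pi_gt_zero by (intro sin_ge_zero) linarith+
    ultimately have "cos \<beta> \<le> 0" by simp
    then have "Y (x - p) * cos \<beta> \<le> 0" using assms(6) by (simp add: mult_nonneg_nonpos)
    moreover have "X (x - p) * sin \<beta> \<le> X (x - p)" using assms(7) sin_le_one by (simp add: mult_left_le)
    ultimately have "proj N j p x \<le> X (x - p)" using j(2) unfolding \<beta>_def by linarith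
    also have "\<dots> < Y (x - u) * t + Y (p - u) * t" unfolding d using p x by linarith
    also have "\<dots> \<le> h * t + h * t" using p x t by (intro add_mono mult_right_mono) auto
    also have "\<dots> = h * (2 * t)" by simp
    also have "\<dots> \<le> h * 1" using t p by (intro mult_left_mono) auto
    finally show ?thesis by simp
  next
    case False
    then have "real m * \<theta> \<le> real k * \<theta>" using m(2) \<theta>_pos by (intro mult_right_mono) auto
    then have \<beta>4: "\<beta> + \<theta> / 2 < pi / 2"
      using \<theta>_pos unfolding pi_half \<beta>_def distrib_right by linarith
    \<comment> \<open>The height is a difference of values of
      \<open>X * sin \<beta> + Y * cos \<beta>\<close>. \<open>c1\<close> bounds this functional by
      \<open>h\<close> at \<open>x\<close>, through the right side of the triangle;
      \<open>c2\<close> makes it positive at \<open>p\<close>, through the left side.\<close>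
    have "cos (\<theta> / 2) * (t * sin \<beta> + cos \<beta>) = cos (\<beta> - \<theta> / 2)"
      using cos_half_pos unfolding cos_diff[of \<beta> "\<theta> / 2"] t_def tan_def by (simp add: field_simps)
    also have "\<dots> \<le> cos (\<theta> / 2)"
      using \<beta>1 \<beta>4 \<theta>_pos by (intro cos_monotone_0_pi_le) linarith+
    finally have c1: "t * sin \<beta> + cos \<beta> \<le> 1" using cos_half_pos by simp
    have "cos (\<theta> / 2) * (cos \<beta> - t * sin \<beta>) = cos (\<beta> + \<theta> / 2)"
      using cos_half_pos unfolding cos_add[of \<beta> "\<theta> / 2"] t_def tan_def by (simp add: field_simps)
    moreover have "0 < cos (\<beta> + \<theta> / 2)" using \<beta>1 \<beta>4 \<theta>_pos by (intro cos_gt_zero) linarith+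
    ultimately have "0 < cos (\<theta> / 2) * (cos \<beta> - t * sin \<beta>)" by simp
    then have c2: "0 < cos \<beta> - t * sin \<beta>" using cos_half_pos by (simp add: zero_less_mult_iff)
    have "X (x - u) * sin \<beta> \<le> Y (x - u) * t * sin \<beta>"
      using x(2) sin\<beta> by (intro mult_right_mono) auto
    then have "X (x - u) * sin \<beta> + Y (x - u) * cos \<beta> \<le> Y (x - u) * (t * sin \<beta> + cos \<beta>)"
      by (simp add: algebra_simps)
    also have "\<dots> \<le> Y (x - u)" using c1 x(1) by (simp add: mult_left_le)
    finally have 1: "X (x - u) * sin \<beta> + Y (x - u) * cos \<beta> \<le> h" using x(3) by simp
    have "- (Y (p - u) * t) * sin \<beta> \<le> X (p - u) * sin \<beta>"
      using p(2) sin\<beta> by (intro mult_right_mono) auto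
    moreover have "0 < Y (p - u) * (cos \<beta> - t * sin \<beta>)" using c2 p(1) by simp
    ultimately have 2: "0 < X (p - u) * sin \<beta> + Y (p - u) * cos \<beta>"
      by (simp add: algebra_simps)
    show ?thesis using 1 2 j(2) unfolding d \<beta>_def by (simp add: algebra_simps)
  qed
  then have "reach (theta_edge P S N) p x (bound j p x)"
    using IH[of p x j] assms j(1) unfolding offs_proj_XY h_def by blast
  then show ?thesis using j(3) by (rule reach_mono)
qed

text \<open>The step points to the right of \<open>w - u\<close>, which is itself within cone
  \<open>i\<close>, so leaning left it cannot leave that cone.\<close>

lemma step_left:
  assumes "p \<in> P" "x \<in> P" "inside p" "inside x" "sees S p x" "0 < Y (x - p)" "X (x - p) \<le> 0"
    and "0 < sg * cross2 (x - p) (w - u)"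
  shows "reach (theta_edge P S N) p x (R (x - p))"
proof -
  have w: "0 < Y (w - u)" "- (Y (w - u) * tan (\<theta> / 2)) < X (w - u)"
    using w_inside unfolding inside_def by linarith+
  have "Y (x - p) * - (Y (w - u) * tan (\<theta> / 2)) < Y (x - p) * X (w - u)"
    using w assms(6) by (intro mult_strict_left_mono)
  then have "Y (w - u) * - X (x - p) < Y (w - u) * (Y (x - p) * tan (\<theta> / 2))"
    using assms(8) unfolding cross2_XY by (simp add: algebra_simps)
  then have "- X (x - p) < Y (x - p) * tan (\<theta> / 2)"
    using w(1) by (simp only: mult_less_cancel_left_pos)
  then show ?thesis using step_in_cone[of p x] assms unfolding R_def by simp
qed

lemma Y_pos_if_nonneg: "\<lbrakk>a \<in> P; b \<in> P; a \<noteq> b; 0 \<le> Y (b - a)\<rbrakk> \<Longrightarrow> 0 < Y (b - a)"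
  using proj_nonzero[of a b i] i_less unfolding offs_proj_XY by simp

text \<open>Maintains the invariant of the chain inductions that no point of the triangle is lower
  than its apex: later directions lie between the ascending vectors \<open>x - p\<close> and
  \<open>w - u\<close>. General position makes every step strictly ascending.\<close>

lemma wrap_step_facts:
  assumes "apex p" "inside p" "\<forall>y\<in>tri p. 0 \<le> Y (y - p)" "wrap_step p x"
  shows "p \<in> P" "x \<in> P" "inside x" "sees S p x" "0 < Y (x - p)"
    and "x \<noteq> w \<Longrightarrow> y \<in> tri x \<Longrightarrow> 0 \<le> Y (y - x)"
proof -
  have x: "x \<in> tri p" "x \<in> P" "x \<noteq> p" using assms(4) by (auto simp: wrap_step_def tri_def)
  show p: "p \<in> P" and "x \<in> P" using assms(1) x by (auto simp: apex_def)
  show "inside x" using tri_inside assms(1,2) x(1) by blast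
  show "sees S p x" using wrap_step_sees assms(1,4) by blast
  show xp: "0 < Y (x - p)" using Y_pos_if_nonneg p x assms(3) by blast
  assume "x \<noteq> w" "y \<in> tri x"
  moreover have "y \<in> tri p" using wrap_step_apex(2)[OF assms(1,4)] calculation by blast
  ultimately show "0 \<le> Y (y - x)"
    using wrap_step_direction[OF assms(1,4), of y x "cone_dir N i"] xp w_inside
    unfolding Y_def inside_def by auto
qed

section \<open>Induction along the chain\<close>

lemma card_tri_less:
  assumes "apex p" "wrap_step p x" "x \<noteq> w"
  shows "card (tri x) < card (tri p)"
proof (rule psubset_card_mono[OF finite_tri])
  show "tri x \<subset> tri p"
    using wrap_step_apex(2)[OF assms] assms(2) by (auto simp: wrap_step_def)
qed

text \<open>Once the chain leans left and \<open>w - u\<close> does too, all later directions lean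
  left, and the costs \<open>R\<close> telescope.\<close>

lemma chain_left:
  assumes "X (w - u) \<le> 0" "apex p" "inside p" "\<forall>y\<in>tri p. 0 \<le> Y (y - p)"
    "\<forall>y\<in>tri p. X (y - p) \<le> 0"
  shows "reach (theta_edge P S N) p w (R (w - p))"
  using assms(2-)
proof (induction "card (tri p)" arbitrary: p rule: less_induct)
  case less
  obtain x where x: "wrap_step p x" using wrap_step_exists less.prems(1) by blast
  have xt: "x \<in> tri p" using x by (simp add: wrap_step_def)
  note facts = wrap_step_facts[OF less.prems(1-3) x]
  have px: "reach (theta_edge P S N) p x (R (x - p))"
    using step_left facts less.prems xt wrap_step_cross_pos[OF less.prems(1) x] by blast
  show ?case
  proof (cases "x = w")
    case True
    then show ?thesis using px by simp
  next
    case False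
    note ap = wrap_step_apex[OF less.prems(1) x False]
    have "X (y - x) \<le> 0" if "y \<in> tri x" for y
    proof -
      have "0 \<le> (y - x) \<bullet> (- (real_of_int sg *\<^sub>R cone_perp N i))"
        using wrap_step_direction[OF less.prems(1) x, of y x "- (real_of_int sg *\<^sub>R cone_perp N i)"]
          ap that bspec[OF less.prems(4) xt] assms(1) unfolding X_def by auto
      then show ?thesis by (simp add: X_def)
    qed
    then have "reach (theta_edge P S N) x w (R (w - x))"
      using less.hyps[of x] card_tri_less[OF less.prems(1) x False] ap facts(3) facts(6)[OF False] by blast
    from reach_trans[OF px this] show ?thesis by (simp add: LR_diff)
  qed
qed

text \<open>Each step to the right pays exactly the change of the potential \<open>L\<close>; the
  first step to the left hands over to \<open>chain_left\<close>.\<close>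

lemma chain:
  assumes "apex p" "inside p" "\<forall>y\<in>tri p. 0 \<le> Y (y - p)"
  shows "reach (theta_edge P S N) p w (max (L (w - u)) (R (w - u)) - L (p - u))"
  using assms
proof (induction "card (tri p)" arbitrary: p rule: less_induct)
  case less
  obtain x where x: "wrap_step p x" using wrap_step_exists less.prems(1) by blast
  have xt: "x \<in> tri p" using x by (simp add: wrap_step_def)
  note facts = wrap_step_facts[OF less.prems(1-3) x]
  note cr = wrap_step_cross_pos[OF less.prems(1) x]
  show ?case
  proof (cases "0 \<le> X (x - p)")
    case True
    have px: "reach (theta_edge P S N) p x (L (x - p))"
      using step_right facts(1-5) less.prems(2) True by blast
    show ?thesis
    proof (cases "x = w")
      case True
      show ?thesis by (rule reach_mono[OF px[unfolded True]]) (simp add: LR_diff)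
    next
      case False
      have "reach (theta_edge P S N) x w (max (L (w - u)) (R (w - u)) - L (x - u))" (is "reach _ _ _ (?M - _)")
        using less.hyps[of x] card_tri_less[OF less.prems(1) x False] wrap_step_apex[OF less.prems(1) x False]
          facts(3) facts(6)[OF False] by blast
      then have "reach (theta_edge P S N) p w (L (x - p) + (?M - L (x - u)))" by (rule reach_trans[OF px])
      moreover have "L (x - p) + (?M - L (x - u)) = ?M - L (p - u)" unfolding LR_diff by linarith
      ultimately show ?thesis by simp
    qed
  next
    case False
    have w: "0 < Y (w - u)" using w_inside by (simp add: inside_def)
    \<comment> \<open>A step that leans left still points to the right of \<open>w - u\<close>, so
      \<open>w\<close> lies left of the bisector, and hence so does \<open>p\<close>.\<close>
    have "Y (x - p) * X (w - u) < X (x - p) * Y (w - u)"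
      using cr unfolding cross2_XY by simp
    also have "\<dots> < 0" using False w by (simp add: mult_neg_pos)
    finally have wX: "X (w - u) < 0" using facts(5) by (simp add: mult_less_0_iff)
    have "0 < sg * cross2 (w - u) (p - u)"
      using less.prems(1) by (simp add: apex_def orient_def)
    then have "Y (w - u) * X (p - u) < X (w - u) * Y (p - u)"
      unfolding cross2_XY by simp
    also have "\<dots> < 0" using wX less.prems(2) by (simp add: mult_neg_pos inside_def)
    finally have pX: "X (p - u) < 0" using w by (simp add: mult_less_0_iff)
    have "X (y - p) \<le> 0" if "y \<in> tri p" for y
    proof -
      have "0 \<le> (y - p) \<bullet> (- (real_of_int sg *\<^sub>R cone_perp N i))"
        using wrap_step_direction[OF less.prems(1) x that, of p "- (real_of_int sg *\<^sub>R cone_perp N i)"]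
          False wX unfolding X_def by auto
      then show ?thesis by (simp add: X_def)
    qed
    then have "reach (theta_edge P S N) p w (R (w - p))"
      using chain_left[of p] wX less.prems by simp
    then show ?thesis
    proof (rule reach_mono)
      \<comment> \<open>Switching from \<open>L\<close> to \<open>R\<close> loses nothing, because
        left of the bisector \<open>R\<close> is the larger of the two.\<close>
      have "c * X (p - u) \<le> c * - X (p - u)" using pX c_ge_1 by (intro mult_left_mono) auto
      then have "L (p - u) \<le> R (p - u)" unfolding L_def R_def by (simp add: algebra_simps)
      moreover have "R (w - p) = R (w - u) - R (p - u)" by (simp add: LR_diff)
      ultimately show "R (w - p) \<le> max (L (w - u)) (R (w - u)) - L (p - u)" by linarith
    qed
  qed
qed

lemma bound_eq_max: "max (L (w - u)) (R (w - u)) = bound i u w"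
proof -
  have "max (c * X (w - u)) (c * - X (w - u)) = c * \<bar>X (w - u)\<bar>"
    using c_ge_1 by (simp add: abs_if max_def mult_le_0_iff)
  then show ?thesis
    unfolding L_def R_def bound_def offs_proj_XY distrib_left max_def by (auto split: if_splits)
qed

text \<open>The segment is no longer than the detour along the side and the base, and the weight
  \<open>c\<close> is at least 1.\<close>

lemma dist_le_L:
  assumes "inside v" shows "dist u v \<le> L (v - u)"
proof -
  let ?x = "X (v - u)" and ?y = "Y (v - u)" and ?t = "tan (\<theta> / 2)"
  have v: "0 < ?y" "0 < ?x + ?y * ?t" using assms unfolding inside_def by linarith+
  have "\<bar>offs N i u v\<bar>\<^sup>2 = \<bar>?x\<bar>\<^sup>2" unfolding offs_proj_XY ..
  then have dist: "(dist u v)\<^sup>2 = ?x\<^sup>2 + ?y\<^sup>2"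
    unfolding dist_offs_proj[of u v i] offs_proj_XY(3) by simp
  have q: "(1 / cos (\<theta> / 2))\<^sup>2 = 1 + ?t\<^sup>2"
    using tan_sec[of "\<theta> / 2"] cos_half_pos by (simp add: inverse_eq_divide power_divide)
  have tri: "sqrt (?x\<^sup>2 + ?y\<^sup>2) \<le> ?y / cos (\<theta> / 2) + (?x + ?y * ?t)"
  proof (rule real_le_lsqrt)
    have "0 \<le> ?y / cos (\<theta> / 2)" using v cos_half_pos by simp
    then show nn: "0 \<le> ?y / cos (\<theta> / 2) + (?x + ?y * ?t)" using v by linarith
    let ?s = "1 / cos (\<theta> / 2)"
    have "0 \<le> 2 * ?y * (?x + ?y * ?t) * (?s + ?t)" using v tan_half_pos cos_half_pos by simp
    \<comment> \<open>The squared detour exceeds the squared distance by a product of nonnegative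
      factors.\<close>
    moreover have "(y * s + (x + y * t))\<^sup>2 = x\<^sup>2 + y\<^sup>2 + 2 * y * (x + y * t) * (s + t)"
      if "s\<^sup>2 = 1 + t\<^sup>2" for x y s t :: real
      using that by algebra
    note this[OF q, of ?y ?x]
    ultimately show "?x\<^sup>2 + ?y\<^sup>2 \<le> (?y / cos (\<theta> / 2) + (?x + ?y * ?t))\<^sup>2" by simp
  qed
  have "dist u v = sqrt (?x\<^sup>2 + ?y\<^sup>2)" using dist by (metis real_sqrt_abs abs_of_nonneg zero_le_dist)
  also note tri
  also have "?y / cos (\<theta> / 2) + (?x + ?y * ?t) \<le> L (v - u)"
    using v c_ge_1 unfolding L_def by (simp add: mult_le_cancel_right1)
  finally show ?thesis .
qed

text \<open>The edge \<open>uv\<close> costs at most \<open>L (v - u)\<close>, exactly what the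
  bound for the chain leaves over.\<close>

lemma sector_step:
  assumes "theta_edge P S N u v" "apex v" "inside v"
    and closest: "\<And>x. x \<in> tri v \<Longrightarrow> sees S u x \<Longrightarrow> proj N i u v \<le> proj N i u x"
  shows "reach (theta_edge P S N) u w (bound i u w)"
proof -
  obtain x where x: "wrap_step v x" using wrap_step_exists assms(2) by blast
  have xt: "x \<in> tri v" using x by (simp add: wrap_step_def)
  \<comment> \<open>Only visible points compete with \<open>v\<close>; the first chain point is
    visible, hence not lower than \<open>v\<close>, and the turning of the chain extends this to the
    whole triangle.\<close>
  have "sees S u x"
    using wrap_step_sees[OF assms(2) x, of u] sees_uw by blast
  then have "0 \<le> Y (x - v)"
    using closest[OF xt] unfolding offs_proj_XY XY_diff by simp
  then have "0 \<le> Y (y - v)" if "y \<in> tri v" for y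
    using wrap_step_direction[OF assms(2) x that, of v "cone_dir N i"] w_inside
    unfolding Y_def inside_def by auto
  then have "reach (theta_edge P S N) v w (bound i u w - L (v - u))"
    using chain[OF assms(2,3)] unfolding bound_eq_max by blast
  from reach_trans[OF reach_edge[of "theta_edge P S N", OF assms(1) dist_le_L[OF assms(3)]] this]
  show ?thesis by simp
qed

end

section \<open>The spanning bound\<close>

context theta_config
begin

text \<open>The slope of \<open>y\<close> is a weighted average of those of \<open>v\<close> and
  \<open>w\<close>, so subcones are convex. If both weights are positive and the slopes differ, the
  average avoids the two borders.\<close>

lemma in_subcone_combination:
  assumes v: "in_subcone N u i a b v" and w: "in_subcone N u i a b w"
    and AB: "0 \<le> A" "0 < B" "0 < D"
    and pr: "D * proj N i u y = A * proj N i u v + B * proj N i u w"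
    and off: "D * offs N i u y = A * offs N i u v + B * offs N i u w"
  shows "in_subcone N u i a b y"
    and "0 < A \<Longrightarrow> slope N i u v \<noteq> slope N i u w \<Longrightarrow> a < slope N i u y \<and> slope N i u y < b"
proof -
  let ?t = "tan (\<theta> / 2)"
  have vw: "0 < proj N i u v" "0 < proj N i u w" "i < N"
    using v w by (auto simp: in_subcone_def in_cone_def)
  have slope: "offs N i u v = slope N i u v * proj N i u v" "offs N i u w = slope N i u w * proj N i u w"
    using vw by (auto simp: slope_def)
  have "0 < D * proj N i u y" unfolding pr using vw AB by (simp add: add_nonneg_pos)
  then have y: "0 < proj N i u y" using AB by (simp add: zero_less_mult_iff)
  \<comment> \<open>Here \<open>c\<close> is an arbitrary slope and shadows the constant of the
    bound.\<close>
  have ge: "c \<le> slope N i u y" if "c \<le> slope N i u v" "c \<le> slope N i u w" for c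
  proof -
    have "D * (c * proj N i u y) = A * (c * proj N i u v) + B * (c * proj N i u w)"
      using arg_cong[OF pr, of "\<lambda>z. c * z"] by (simp add: algebra_simps)
    also have "\<dots> \<le> D * offs N i u y"
      unfolding off slope using that AB vw by (intro add_mono mult_left_mono mult_right_mono) auto
    finally show ?thesis using y AB by (simp add: slope_def field_simps)
  qed
  have le: "slope N i u y \<le> c" if "slope N i u v \<le> c" "slope N i u w \<le> c" for c
  proof -
    have "D * offs N i u y \<le> A * (c * proj N i u v) + B * (c * proj N i u w)"
      unfolding off slope using that AB vw by (intro add_mono mult_left_mono mult_right_mono) auto
    also have "\<dots> = D * (c * proj N i u y)"
      using arg_cong[OF pr, of "\<lambda>z. c * z"] by (simp add: algebra_simps)
    finally show ?thesis using y AB by (simp add: slope_def field_simps)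
  qed
  have cone: "in_cone N u i z \<longleftrightarrow> - ?t < slope N i u z \<and> slope N i u z < ?t" if "0 < proj N i u z" for z
    using that vw unfolding in_cone_def half_angle slope_def by (auto simp: field_simps abs_less_iff)
  have bd: "- ?t < slope N i u v" "slope N i u v < ?t" "- ?t < slope N i u w" "slope N i u w < ?t"
    using v w vw cone by (auto simp: in_subcone_def)
  have "min (slope N i u v) (slope N i u w) \<le> slope N i u y" "slope N i u y \<le> max (slope N i u v) (slope N i u w)"
    by (auto intro: ge le)
  then have "in_cone N u i y" using bd y cone by auto
  then show "in_subcone N u i a b y"
    using v w ge[of a] le[of b] by (auto simp: in_subcone_def)
  assume A: "0 < A" and ne: "slope N i u v \<noteq> slope N i u w"
  have comb: "D * proj N i u y * (slope N i u y - c) =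
      A * proj N i u v * (slope N i u v - c) + B * proj N i u w * (slope N i u w - c)" for c
  proof -
    have "D * proj N i u y * (slope N i u y - c) = D * offs N i u y - c * (D * proj N i u y)"
      using y by (simp add: slope_def field_simps)
    also have "\<dots> = A * proj N i u v * (slope N i u v - c) + B * proj N i u w * (slope N i u w - c)"
      unfolding off pr slope by (simp add: algebra_simps)
    finally show ?thesis .
  qed
  have "slope N i u y \<noteq> c" if "c \<le> slope N i u v \<and> c \<le> slope N i u w \<or> slope N i u v \<le> c \<and> slope N i u w \<le> c" for c
  proof
    assume "slope N i u y = c"
    then have 0: "A * proj N i u v * (slope N i u v - c) + B * proj N i u w * (slope N i u w - c) = 0"
      using comb[of c] by simp
    have "0 < A * proj N i u v" "0 < B * proj N i u w" using A AB vw by auto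
    note K = this
    from that have "A * proj N i u v * (slope N i u v - c) = 0 \<and> B * proj N i u w * (slope N i u w - c) = 0"
    proof
      assume "c \<le> slope N i u v \<and> c \<le> slope N i u w"
      then have "0 \<le> A * proj N i u v * (slope N i u v - c)" "0 \<le> B * proj N i u w * (slope N i u w - c)"
        using K by auto
      then show ?thesis using 0 by linarith
    next
      assume "slope N i u v \<le> c \<and> slope N i u w \<le> c"
      then have "A * proj N i u v * (slope N i u v - c) \<le> 0" "B * proj N i u w * (slope N i u w - c) \<le> 0"
        using K by (auto intro!: mult_nonneg_nonpos)
      then show ?thesis using 0 by linarith
    qed
    then have "slope N i u v = c \<and> slope N i u w = c" using K by auto
    then show False using ne by simp
  qed
  then show "a < slope N i u y \<and> slope N i u y < b"
    using v w ge[of a] le[of b] unfolding in_subcone_def by (metis order_le_less)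
qed

text \<open>Takes the splitting values next to the slope of \<open>w\<close>; the tangents of the
  cone boundary guarantee one on each side. If that slope is itself a splitting value, it becomes
  the lower border.\<close>

lemma subcone_exists:
  assumes "in_cone N u i w"
  shows "\<exists>a b. is_subcone P S N u i a b \<and> in_subcone N u i a b w"
proof -
  define V where "V = split_vals P S N u i"
  define z where "z = slope N i u w"
  have "V = slope N i u ` {v \<in> P. is_constraint S u v \<and> in_cone N u i v} \<union> {- tan (pi / real N), tan (pi / real N)}"
    by (auto simp: V_def split_vals_def)
  then have fin: "finite V" using finite_P by simp
  have z: "- tan (pi / real N) < z" "z < tan (pi / real N)"
    using assms unfolding z_def slope_def in_cone_def by (auto simp: field_simps abs_less_iff)
  have lo: "finite {c \<in> V. c \<le> z}" "{c \<in> V. c \<le> z} \<noteq> {}"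
    using fin z by (auto simp: V_def split_vals_def)
  have hi: "finite {c \<in> V. z < c}" "{c \<in> V. z < c} \<noteq> {}"
    using fin z by (auto simp: V_def split_vals_def)
  define a where "a = Max {c \<in> V. c \<le> z}"
  define b where "b = Min {c \<in> V. z < c}"
  have a: "a \<in> V" "a \<le> z" using Max_in[OF lo] by (auto simp: a_def)
  have b: "b \<in> V" "z < b" using Min_in[OF hi] by (auto simp: b_def)
  have "\<not> (a < c \<and> c < b)" if "c \<in> V" for c
  proof (cases "c \<le> z")
    case True
    then have "c \<le> a" unfolding a_def using that lo by (intro Max_ge) auto
    then show ?thesis by simp
  next
    case False
    then have "b \<le> c" unfolding b_def using that hi by (intro Min_le) auto
    then show ?thesis by simp
  qed
  then have "is_subcone P S N u i a b" using a b by (simp add: is_subcone_def V_def)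
  moreover have "in_subcone N u i a b w" using a b assms by (auto simp: in_subcone_def z_def)
  ultimately show ?thesis by blast
qed

section \<open>Induction on the height of the canonical triangle\<close>

lemma reach_bound:
  assumes "u \<in> P" "w \<in> P" "sees S u w" "in_cone N u i w"
  shows "reach (theta_edge P S N) u w (bound i u w)"
  using assms
\<comment> \<open>Heights are real numbers; counting the triples of two points and a cone with
  smaller height makes the induction well-founded.\<close>
proof (induction "card {(a, b, j) \<in> P \<times> P \<times> {..<N}. proj N j a b < proj N i u w}"
    arbitrary: u w i rule: less_induct)
  case less
  have IH: "reach (theta_edge P S N) a b (bound j a b)"
    if "a \<in> P" "b \<in> P" "sees S a b" "in_cone N a j b" "proj N j a b < proj N i u w" for a b j
  proof (rule less.hyps)
    have "j < N" using that by (simp add: in_cone_def)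
    show "card {(a', b', j') \<in> P \<times> P \<times> {..<N}. proj N j' a' b' < proj N j a b}
        < card {(a', b', j') \<in> P \<times> P \<times> {..<N}. proj N j' a' b' < proj N i u w}"
    proof (rule psubset_card_mono)
      show "finite {(a', b', j') \<in> P \<times> P \<times> {..<N}. proj N j' a' b' < proj N i u w}"
        using finite_P by (auto intro: finite_subset[of _ "P \<times> P \<times> {..<N}"])
      have "(a, b, j) \<in> {(a', b', j') \<in> P \<times> P \<times> {..<N}. proj N j' a' b' < proj N i u w}"
        "(a, b, j) \<notin> {(a', b', j') \<in> P \<times> P \<times> {..<N}. proj N j' a' b' < proj N j a b}"
        using that \<open>j < N\<close> by auto
      moreover have "{(a', b', j') \<in> P \<times> P \<times> {..<N}. proj N j' a' b' < proj N j a b} \<subseteq>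
        {(a', b', j') \<in> P \<times> P \<times> {..<N}. proj N j' a' b' < proj N i u w}"
        using that(5) by (auto intro: less_trans)
      ultimately show "{(a', b', j') \<in> P \<times> P \<times> {..<N}. proj N j' a' b' < proj N j a b} \<subset>
        {(a', b', j') \<in> P \<times> P \<times> {..<N}. proj N j' a' b' < proj N i u w}" by blast
    qed
  qed (use that in auto)
  have sector: "theta_sector k P S u w sg i" if "sg = 1 \<or> sg = -1" for sg
    using that less.prems IH by unfold_locales auto
  obtain a b where sub: "is_subcone P S N u i a b" and wsub: "in_subcone N u i a b w"
    using subcone_exists less.prems(4) by blast
  define Q where "Q = {y \<in> P. in_subcone N u i a b y \<and> sees S u y}"
  have "w \<in> Q" using less.prems wsub by (simp add: Q_def)
  then have "proj N i u ` Q \<noteq> {}" by blast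
  moreover have "finite (proj N i u ` Q)" using finite_P by (simp add: Q_def)
  ultimately have "Min (proj N i u ` Q) \<in> proj N i u ` Q" by (intro Min_in)
  then obtain v where vQ: "v \<in> Q" and "proj N i u v = Min (proj N i u ` Q)" by fastforce
  then have vmin: "proj N i u v \<le> proj N i u x" if "x \<in> Q" for x
    using that \<open>finite (proj N i u ` Q)\<close> by simp
  have v: "v \<in> P" "in_subcone N u i a b v" "sees S u v" using vQ by (auto simp: Q_def)
  have "theta_selects P S N u v"
    unfolding theta_selects_def using sub v vmin unfolding Q_def by blast
  then have edge: "theta_edge P S N u v" using less.prems v by (simp add: theta_edge_def)
  show ?case
  proof (cases "v = w")
    case True
    interpret theta_sector k P S u w 1 i using sector by simp
    have "dist u w \<le> bound i u w" using dist_le_L[OF w_inside] bound_eq_max by linarith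
    then show ?thesis using edge True by (simp add: reach_edge)
  next
    case False
    have pos: "0 < proj N i u v" "0 < proj N i u w"
      using v wsub by (auto simp: in_subcone_def in_cone_def)
    then have ne: "u \<noteq> v" "u \<noteq> w" by (auto simp: proj_def)
    then have nz: "orient 1 u w v \<noteq> 0"
      using False less.prems v by (intro orient_nonzero) auto
    \<comment> \<open>The reflection is chosen so that \<open>v\<close> comes to lie left of
      \<open>uw\<close>.\<close>
    define sg :: int where "sg = (if 0 < orient 1 u w v then 1 else -1)"
    have sg: "sg = 1 \<or> sg = -1" by (simp add: sg_def)
    interpret theta_sector k P S u w sg i using sector[OF sg] .
    have D: "0 < orient sg u w v" using nz by (auto simp: sg_def orient_def)
    have bary: "orient sg u w v * proj N i u y = orient sg u w y * proj N i u v + orient sg v u y * proj N i u w"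
      "orient sg u w v * offs N i u y = orient sg u w y * offs N i u v + orient sg v u y * offs N i u w" for y
      unfolding proj_def offs_def by (rule orient_barycentric)+
    have slopes: "slope N i u v \<noteq> slope N i u w"
    proof
      assume "slope N i u v = slope N i u w"
      then have "offs N i u w * proj N i u v = proj N i u w * offs N i u v"
        using pos by (simp add: slope_def field_simps)
      then have "X (w - u) * Y (v - u) = Y (w - u) * X (v - u)"
        unfolding offs_proj_XY(1,3)[symmetric] by simp
      then show False using D unfolding orient_def cross2_XY by simp
    qed
    have ap: "apex v"
      unfolding apex_def
    proof (intro conjI allI impI notI)
      fix z assume z: "is_constraint S u z" "0 < orient sg u w z \<and> 0 < orient sg v u z"
      \<comment> \<open>A constraint at \<open>u\<close> between \<open>uv\<close> and
        \<open>uw\<close> would be a splitting value strictly inside the subcone.\<close>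
      have zz: "in_subcone N u i a b z" "a < slope N i u z \<and> slope N i u z < b"
        using in_subcone_combination[OF v(2) wsub _ _ D bary] z(2) slopes by auto
      have "slope N i u z \<in> split_vals P S N u i"
        using zz(1) z(1) constraint_in_P[OF z(1)] unfolding split_vals_def in_subcone_def by blast
      then show False using sub zz(2) by (auto simp: is_subcone_def)
    qed (use v D in auto)
    show ?thesis
    proof (rule sector_step[OF edge ap])
      show "inside v"
        unfolding inside_iff using v vmin[of w] less.prems wsub by (auto simp: in_subcone_def Q_def)
      fix x assume x: "x \<in> tri v" "sees S u x"
      have "in_subcone N u i a b x"
        using in_subcone_combination(1)[OF v(2) wsub _ _ D bary] tri_orient_pos[OF ap x(1)] x(1)
        by (auto simp: tri_def)
      then show "proj N i u v \<le> proj N i u x" using vmin x by (auto simp: Q_def tri_def)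
    qed
  qed
qed

end

section \<open>From corner distances to the angle \<alpha>\<close>

theorem theorem4:
  fixes k :: nat and P :: "pt set" and S :: "(pt \<times> pt) set" and u w :: pt and i :: nat
  defines "N \<equiv> 4 * k + 3"
  defines "\<theta> \<equiv> 2 * pi / real (4 * k + 3)"
  defines "\<alpha> \<equiv> uangle (w - u) (canon_mid (4 * k + 3) u i w - u)"
  assumes "k \<ge> 1"
    and "finite P"
    and "general_position N P"
    and "valid_constraints P S"
    and "u \<in> P" and "w \<in> P"
    and "sees S u w"
    and "in_cone N u i w"
  shows "\<exists>xs. is_path (theta_edge P S N) xs u w \<and>
           path_length xs \<le>
             (cos \<alpha> / cos (\<theta> / 2)
              + (cos \<alpha> * tan (\<theta> / 2) + sin \<alpha>) * cos (\<theta> / 4)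
                / (cos (\<theta> / 2) - sin (3 * \<theta> / 4))) * dist u w"
proof -
  interpret tt: theta_trig k using assms(4) by unfold_locales
  have N: "N = tt.N" by (simp add: N_def tt.N_def)
  have th: "\<theta> = tt.\<theta>" by (simp add: \<theta>_def tt.\<theta>_def tt.N_def)
  interpret theta_config k P S
  proof unfold_locales
    show "general_position tt.N P" using assms(6) unfolding N .
    show "\<not> collinear {a, b, c}" if "a \<in> P" "b \<in> P" "c \<in> P" "a \<noteq> b" "a \<noteq> c" "b \<noteq> c" for a b c
      using that assms(6) unfolding general_position_def by blast
  qed (use assms in auto)
  define p where "p = proj N i u w"
  define d where "d = dist u w"
  have p: "0 < p" using assms(11) by (simp add: in_cone_def p_def)
  then have "u \<noteq> w" by (auto simp: p_def proj_def)
  then have d: "0 < d" by (simp add: d_def)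
  have dd: "d\<^sup>2 = (offs N i u w)\<^sup>2 + p\<^sup>2" unfolding d_def p_def N by (rule tt.dist_offs_proj)
  then have "p\<^sup>2 \<le> d\<^sup>2" by simp
  then have pd: "p \<le> d" by (rule power2_le_imp_le) (use d in simp)
  have mid: "canon_mid (4 * k + 3) u i w - u = p *\<^sub>R cone_dir N i"
    by (simp add: canon_mid_def p_def N_def)
  have "norm (cone_dir N i) = 1" by (simp add: cone_dir_def norm_Pair)
  \<comment> \<open>\<open>um\<close> has length \<open>p\<close> along the unit bisector, and
    \<open>p\<close> is also the projection of \<open>uw\<close> on it.\<close>
  then have "\<alpha> = arccos (p * p / (d * p))"
    unfolding \<alpha>_def uangle_def mid using p
    by (simp add: d_def p_def proj_def dist_norm norm_minus_commute)
  then have \<alpha>: "\<alpha> = arccos (p / d)" using p by simp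
  have pd1: "-1 \<le> p / d" "p / d \<le> 1" using p d pd by (auto simp: field_simps)
  have cos: "cos \<alpha> = p / d" unfolding \<alpha> using pd1 by simp
  have "1 - (p / d)\<^sup>2 = (\<bar>offs N i u w\<bar> / d)\<^sup>2"
  proof -
    have "1 - (p / d)\<^sup>2 = (d\<^sup>2 - p\<^sup>2) / d\<^sup>2" using d by (simp add: power_divide diff_divide_distrib)
    also have "\<dots> = (\<bar>offs N i u w\<bar> / d)\<^sup>2" using dd by (simp add: power_divide)
    finally show ?thesis .
  qed
  then have sin: "sin \<alpha> = \<bar>offs N i u w\<bar> / d"
    unfolding \<alpha> using pd1 d by (simp add: sin_arccos)
  have "cos \<alpha> * tan (\<theta> / 2) + sin \<alpha> = (p * tan (\<theta> / 2) + \<bar>offs N i u w\<bar>) / d"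
    unfolding cos sin by (simp add: add_divide_distrib)
  moreover have "(q / d / C + r / d * K / M) * d = q / C + K / M * r" for q r C K M :: real
    using d by (simp only: distrib_right) simp
  ultimately have "(cos \<alpha> / cos (\<theta> / 2) + (cos \<alpha> * tan (\<theta> / 2) + sin \<alpha>) * cos (\<theta> / 4)
      / (cos (\<theta> / 2) - sin (3 * \<theta> / 4))) * d = bound i u w"
    unfolding cos bound_def tt.c_def th[symmetric] N[symmetric] p_def[symmetric] by metis
  then show ?thesis
    using reach_bound[of u w i] assms unfolding reach_def N d_def by simp
qed

end
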